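(* Let $G$ be a bipartite graph with sides $A$ and $B$, both infinite, such that $G$ is a dHp graph and every vertex of $A$ has finite degree in $G$. Suppose that for each $v\in B$, either $N(v)$ is finite or $N(v)=A\setminus F_v$ for some finite set $F_v\subset A$. Then there is a collection of pairwise vertex-disjoint 2-regular subgraphs of $G$ covering all the vertices of $A$.
   Context: For $X\subseteq V(G)$ with $|X|\ge 2$, $N^2_G(X)$ (or $N^2(X)$) denotes the set of vertices of $G$ having at least two neighbours in $X$. A bipartite graph $G$ with sides $A$ and $B$ is a dHp graph (satisfies the double Hall property) if $|A|\ge 2$ and $|N^2(X)|\ge |X|$ for every $X\subseteq A$ with $|X|\ge 2$. $N(v)$ denotes the set of neighbours of $v$. A 2-regular subgraph is a subgraph in which every vertex has degree exactly $2$ (its components are finite cycles or double rays, i.e. two-way infinite paths). A collection of subgraphs covers $A$ if every vertex of $A$ lies in one of them. *)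

theory Defs
  imports Main "HOL-Library.Equipollence"
begin

text \<open>Simple undirected graphs, possibly infinite: a vertex set together with a set of
  two-element edges.\<close>

type_synonym 'a ugraph = "'a set \<times> 'a set set"

abbreviation verts :: "'a ugraph \<Rightarrow> 'a set" where
  "verts G \<equiv> fst G"

abbreviation edges :: "'a ugraph \<Rightarrow> 'a set set" where
  "edges G \<equiv> snd G"

definition simple_graph :: "'a ugraph \<Rightarrow> bool" where
  "simple_graph G \<longleftrightarrow> (\<forall>e\<in>edges G. e \<subseteq> verts G \<and> card e = 2)"

definition neighbours :: "'a ugraph \<Rightarrow> 'a \<Rightarrow> 'a set" where
  "neighbours G v = {u. {u, v} \<in> edges G}"

definition subgraph :: "'a ugraph \<Rightarrow> 'a ugraph \<Rightarrow> bool" where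
  "subgraph H G \<longleftrightarrow> simple_graph H \<and> verts H \<subseteq> verts G \<and> edges H \<subseteq> edges G"

text \<open>Infinite sets have \<^const>\<open>card\<close> 0, so a cardinality of 2 entails finite degree.\<close>

definition two_regular :: "'a ugraph \<Rightarrow> bool" where
  "two_regular H \<longleftrightarrow> (\<forall>v\<in>verts H. card (neighbours H v) = 2)"

definition bipartite :: "'a ugraph \<Rightarrow> 'a set \<Rightarrow> 'a set \<Rightarrow> bool" where
  "bipartite G A B \<longleftrightarrow> simple_graph G \<and> verts G = A \<union> B \<and> A \<inter> B = {} \<and>
     (\<forall>e\<in>edges G. \<exists>a\<in>A. \<exists>b\<in>B. e = {a, b})"

text \<open>Stated without \<^const>\<open>card\<close>, since the sets in question may be infinite.\<close>

definition at_least_two :: "'a set \<Rightarrow> bool" where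
  "at_least_two X \<longleftrightarrow> (\<exists>x\<in>X. \<exists>y\<in>X. x \<noteq> y)"

definition N2 :: "'a ugraph \<Rightarrow> 'a set \<Rightarrow> 'a set" where
  "N2 G X = {v \<in> verts G. at_least_two (neighbours G v \<inter> X)}"

text \<open>The set \<open>X\<close> ranges over infinite subsets of \<open>A\<close> as well; cardinalities are compared by
  the existence of an injection.\<close>

definition dHp_graph :: "'a ugraph \<Rightarrow> 'a set \<Rightarrow> 'a set \<Rightarrow> bool" where
  "dHp_graph G A B \<longleftrightarrow> bipartite G A B \<and> at_least_two A \<and>
     (\<forall>X. X \<subseteq> A \<and> at_least_two X \<longrightarrow> X \<lesssim> N2 G X)"

end

theory Submission
  imports Defs "HOL-Library.Countable_Set"
begin

text \<open>Infinitely many vertices of \<open>B\<close> have a cofinite neighbourhood, since \<open>A\<close> contains an infinite set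
  in which no two vertices share a neighbour of finite degree; as degrees in \<open>A\<close> are finite, \<open>A\<close> is
  countable. A finite graph with the double Hall property has an edge set in which the vertices of
  \<open>A\<close> have degree 2 and those of \<open>B\<close> degree 0 or 2. A compactness argument over the finite subsets
  of \<open>A\<close> then gives such an edge set for the infinite graph, except that cofinite vertices may have
  degree 1. These defects are cancelled in pairs if there are infinitely many of them, and otherwise
  shifted to infinity along cofinite vertices.

  The finite statement is a parity factor theorem. Add two pendant neighbours to every vertex of
  \<open>A\<close>, so that edge sets with degree 2 on \<open>A\<close> and at most 2 elsewhere exist, and take one with the
  fewest odd vertices. If odd vertices remain, a Gallai-Edmonds type analysis of alternating walks
  yields a set \<open>D \<subseteq> A\<close> with fewer than \<open>card D\<close> vertices having two neighbours in \<open>D\<close>.\<close>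

subsection \<open>Alternating walks\<close>

text \<open>Allowing degrees 0 and 2 but not 1 leaves a gap that Hall or flow arguments cannot
  handle; parity replaces them. A pendant in use has degree 1 and is odd, so an edge set without odd
  vertices leaves all pendants idle and is a solution for the original graph.

  The number of odd vertices is always even, so minima change in steps of 2; hence the 2 per deleted
  vertex in the choice of \<open>Z\<close>. If the minimum is positive, it is at least
  \<open>2 + 2 * card Z\<close> after deleting \<open>Z\<close>. On the other side, odd vertices can
  be charged injectively to edges at \<open>D\<close>, two per vertex, so it is at most
  \<open>2 * card D\<close>. Thus \<open>D\<close> is larger than \<open>Z\<close>, which contains
  its common neighbours. A set \<open>D\<close> with one element is invisible to the double Hall
  property and needs a separate argument.

  In the limit, a vertex of finite degree is settled by finitely many edges, so a defect can only
  sit at a cofinite vertex. Such a vertex can take over an edge from almost every vertex of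
  \<open>A\<close>, so every defect lies where there is room to repair it.\<close>

definition degree :: "'v set set \<Rightarrow> 'v \<Rightarrow> nat" where
  "degree M v = card {e \<in> M. v \<in> e}"

definition odd_verts :: "'v set set \<Rightarrow> 'v set" where
  "odd_verts M = {v. odd (degree M v)}"

lemma mem_odd_verts: "v \<in> odd_verts M \<longleftrightarrow> odd (degree M v)"
  by (simp add: odd_verts_def)

lemma degree_insert:
  assumes "finite M" "e \<notin> M"
  shows "degree (insert e M) v = degree M v + of_bool (v \<in> e)"
proof -
  have "{f \<in> insert e M. v \<in> f} = (if v \<in> e then insert e {f \<in> M. v \<in> f} else {f \<in> M. v \<in> f})"
    by auto
  then show ?thesis using assms by (simp add: degree_def)
qed

lemma degree_remove:
  assumes "finite M" "e \<in> M"
  shows "degree M v = degree (M - {e}) v + of_bool (v \<in> e)"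
  using degree_insert[of "M - {e}" e v] assms by (simp add: insert_absorb)

lemma degree_0_iff: "finite M \<Longrightarrow> degree M v = 0 \<longleftrightarrow> (\<forall>e\<in>M. v \<notin> e)"
  by (auto simp: degree_def)

lemma degree_eq_0: "(\<And>e. e \<in> M \<Longrightarrow> v \<notin> e) \<Longrightarrow> degree M v = 0"
  unfolding degree_def by (metis (mono_tags, lifting) Collect_empty_eq card.empty)

lemma degree_mono: "finite M \<Longrightarrow> N \<subseteq> M \<Longrightarrow> degree N v \<le> degree M v"
  unfolding degree_def by (rule card_mono) auto

lemma ex_edge_of_degree_less:
  assumes "finite N" "degree N v < degree M v"
  shows "\<exists>e\<in>M - N. v \<in> e"
proof (rule ccontr)
  assume "\<not> ?thesis"
  then have "{e \<in> M. v \<in> e} \<subseteq> {e \<in> N. v \<in> e}" by auto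
  then have "degree M v \<le> degree N v"
    unfolding degree_def using assms(1) by (intro card_mono) auto
  with assms(2) show False by simp
qed

lemma even_card_flip:
  assumes "finite X" "u \<noteq> v"
  shows "even (card {x. (x \<in> X) \<noteq> (x = u \<or> x = v)}) \<longleftrightarrow> even (card X)"
proof -
  have one: "even (card {x. (x \<in> Y) \<noteq> (x = w)}) \<longleftrightarrow> odd (card Y)" if "finite Y" for Y and w :: 'a
  proof (cases "w \<in> Y")
    case True
    then have "{x. (x \<in> Y) \<noteq> (x = w)} = Y - {w}" by auto
    moreover have "card Y = Suc (card (Y - {w}))" using True that by (metis card.remove)
    ultimately show ?thesis by simp
  next
    case False
    then have "{x. (x \<in> Y) \<noteq> (x = w)} = insert w Y" by auto
    with False that show ?thesis by simp
  qed
  let ?Y = "{x. (x \<in> X) \<noteq> (x = u)}"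
  have fin: "finite ?Y" using assms(1) by (rule_tac finite_subset[of _ "insert u X"]) auto
  have "{x. (x \<in> X) \<noteq> (x = u \<or> x = v)} = {x. (x \<in> ?Y) \<noteq> (x = v)}"
    using assms(2) by auto
  then show ?thesis using one[OF fin] one[OF assms(1)] by simp
qed

lemma odd_verts_insert:
  assumes "finite M" "{u, v} \<notin> M" "u \<noteq> v"
  shows "odd_verts (insert {u, v} M) = {x. (x \<in> odd_verts M) \<noteq> (x = u \<or> x = v)}"
  using assms by (auto simp: odd_verts_def degree_insert)

lemma finite_odd_verts:
  assumes "finite M" "\<And>e. e \<in> M \<Longrightarrow> card e = 2"
  shows "finite (odd_verts M)"
proof -
  have "odd_verts M \<subseteq> \<Union>M"
  proof
    fix v assume "v \<in> odd_verts M"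
    then have "degree M v \<noteq> 0" by (intro notI) (simp add: mem_odd_verts)
    then show "v \<in> \<Union>M" using assms(1) by (auto simp: degree_0_iff)
  qed
  moreover have "finite (\<Union>M)" using assms by (metis card.infinite finite_Union zero_neq_numeral)
  ultimately show ?thesis by (rule finite_subset)
qed

lemma handshake:
  assumes "finite M" "\<And>e. e \<in> M \<Longrightarrow> card e = 2"
  shows "even (card (odd_verts M))"
  using assms
proof (induction M rule: finite_induct)
  case empty
  then show ?case by (simp add: odd_verts_def degree_def)
next
  case (insert e M)
  obtain u v where e: "e = {u, v}" "u \<noteq> v" using insert.prems[of e] by (auto simp: card_2_iff)
  have "finite (odd_verts M)" using insert finite_odd_verts[of M] by simp
  from even_card_flip[OF this e(2)] show ?case
    unfolding e(1) using odd_verts_insert[of M u v] insert.hyps insert.IH insert.prems e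
    by (metis (lifting) insertI2)
qed

text \<open>Alternating walks: at each step an edge at the current vertex is flipped so that its degree
  moves towards its degree in \<open>M'\<close>; every flip decreases the distance to \<open>M'\<close>.\<close>

lemma alternating_walk:
  assumes "finite M" "finite M'"
    and "\<And>e. e \<in> M \<union> M' \<Longrightarrow> card e = 2"
    and "Q M x"
    and "\<And>N t w. Q N t \<Longrightarrow> finite N \<Longrightarrow> t \<noteq> w \<Longrightarrow> {t, w} \<in> M' - N \<Longrightarrow> degree N t < degree M' t
           \<Longrightarrow> Q (insert {t, w} N) w"
    and "\<And>N t w. Q N t \<Longrightarrow> finite N \<Longrightarrow> t \<noteq> w \<Longrightarrow> {t, w} \<in> N - M' \<Longrightarrow> degree N t > degree M' t
           \<Longrightarrow> Q (N - {{t, w}}) w"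
  shows "\<exists>N t. Q N t \<and> degree N t = degree M' t"
  using assms(1,3,4)
proof (induction "card (M - M') + card (M' - M)" arbitrary: M x rule: less_induct)
  case less
  consider "degree M x = degree M' x" | "degree M x < degree M' x" | "degree M x > degree M' x"
    by linarith
  then show ?case
  proof cases
    case 1
    with less.prems show ?thesis by blast
  next
    case 2
    then obtain e where e: "e \<in> M' - M" "x \<in> e"
      using ex_edge_of_degree_less[OF \<open>finite M\<close>] by blast
    then obtain w where w: "e = {x, w}" "x \<noteq> w" using less.prems(2)[of e] by (auto simp: card_2_iff)
    let ?N = "insert {x, w} M"
    have "?N - M' = M - M'" "M' - ?N \<subset> M' - M" using e w by auto
    then have "card (?N - M') + card (M' - ?N) < card (M - M') + card (M' - M)"
      using assms(2) by (metis add_strict_left_mono finite_Diff psubset_card_mono)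
    moreover have "Q ?N w" using assms(5)[of M x w] less.prems e w 2 by blast
    ultimately show ?thesis using less.hyps[of ?N w] less.prems e w by auto
  next
    case 3
    then obtain e where e: "e \<in> M - M'" "x \<in> e"
      using ex_edge_of_degree_less[OF assms(2)] by blast
    then obtain w where w: "e = {x, w}" "x \<noteq> w" using less.prems(2)[of e] by (auto simp: card_2_iff)
    let ?N = "M - {{x, w}}"
    have "M' - ?N = M' - M" "?N - M' \<subset> M - M'" using e w by auto
    then have "card (?N - M') + card (M' - ?N) < card (M - M') + card (M' - M)"
      using less.prems(1) by (metis add_strict_right_mono finite_Diff psubset_card_mono)
    moreover have "Q ?N w" using assms(6)[of M x w] less.prems e w 3 by blast
    ultimately show ?thesis using less.hyps[of ?N w] less.prems by auto
  qed
qed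

text \<open>Invariant of a walk that started at \<open>x\<close> and stands at \<open>t\<close>.
  Either \<open>t\<close> has its degree in \<open>M'\<close>, or one more flip towards
  \<open>M'\<close> gives \<open>t\<close> one of its two original degrees. By the last clause the
  parities in \<open>N\<close> and \<open>M\<close> differ exactly at \<open>x\<close> and
  \<open>t\<close>, and nowhere if \<open>x = t\<close>.\<close>

definition walk_state :: "'v set set \<Rightarrow> 'v set set \<Rightarrow> 'v \<Rightarrow> 'v set set \<Rightarrow> 'v \<Rightarrow> bool" where
  "walk_state M M' x N t \<longleftrightarrow> M \<inter> M' \<subseteq> N \<and> N \<subseteq> M \<union> M' \<and>
     (\<forall>v. v \<noteq> t \<longrightarrow> degree N v \<in> {degree M v, degree M' v}) \<and>
     (degree N t = degree M' t \<or>
      degree N t < degree M' t \<and> Suc (degree N t) \<in> {degree M t, degree M' t} \<or>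
      degree N t > degree M' t \<and> degree N t - 1 \<in> {degree M t, degree M' t}) \<and>
     (\<forall>v. odd (degree N v) \<longleftrightarrow> (odd (degree M v) \<longleftrightarrow> ((v = x) \<longleftrightarrow> (v = t))))"

text \<open>Degrees at most 2 of different parity differ by exactly 1, so a single flip settles
  \<open>x\<close>.\<close>

lemma walk_state_init:
  assumes "degree M x \<le> 2" "degree M' x \<le> 2" "odd (degree M x) \<noteq> odd (degree M' x)"
  shows "walk_state M M' x M x"
proof -
  have "degree M x \<in> {0,1,2}" "degree M' x \<in> {0,1,2}" using assms by auto
  then show ?thesis using assms(3) by (auto simp: walk_state_def)
qed

lemma walk_stateD:
  assumes "walk_state M M' x N t"
  shows "M \<inter> M' \<subseteq> N" "N \<subseteq> M \<union> M'"
    and "v \<noteq> t \<Longrightarrow> degree N v = degree M v \<or> degree N v = degree M' v"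
    and "degree N t = degree M' t \<or>
      degree N t < degree M' t \<and> (Suc (degree N t) = degree M t \<or> Suc (degree N t) = degree M' t) \<or>
      degree N t > degree M' t \<and> (degree N t - 1 = degree M t \<or> degree N t - 1 = degree M' t)"
    and "odd (degree N v) \<longleftrightarrow> (odd (degree M v) \<longleftrightarrow> ((v = x) \<longleftrightarrow> (v = t)))"
  using assms unfolding walk_state_def insert_iff empty_iff by blast+

lemma walk_state_insert:
  assumes "\<And>v. degree M v \<le> 2" "\<And>v. degree M' v \<le> 2"
    and "walk_state M M' x N t" "finite N" "t \<noteq> w" "{t, w} \<in> M' - N" "degree N t < degree M' t"
  shows "walk_state M M' x (insert {t, w} N) w"
proof -
  note ws = walk_stateD[OF assms(3)]
  let ?d = "degree (insert {t, w} N)"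
  have dg: "?d v = degree N v + of_bool (v = t \<or> v = w)" for v
    using degree_insert[of N "{t, w}" v] assms by simp
  have t: "?d t = degree M t \<or> ?d t = degree M' t" using ws(4) assms(7) dg[of t] by auto
  have w: "degree N w = degree M w \<or> degree N w = degree M' w" using ws(3) assms(5) by metis
  have "degree M w = 0 \<or> degree M w = 1 \<or> degree M w = 2" using assms(1)[of w] by linarith
  moreover have "degree M' w = 0 \<or> degree M' w = 1 \<or> degree M' w = 2"
    using assms(2)[of w] by linarith
  \<comment> \<open>The bound 2 is needed if \<open>w\<close> leaves its degree in \<open>M\<close>
    and still stays below its degree in \<open>M'\<close>: this can only be the way from 0 to 2, and
    one more flip completes it.\<close>
  ultimately have 1: "?d w = degree M' w \<or>
      ?d w < degree M' w \<and> Suc (?d w) \<in> {degree M w, degree M' w} \<or>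
      ?d w > degree M' w \<and> ?d w - 1 \<in> {degree M w, degree M' w}"
    using w dg[of w] by auto
  have 2: "?d v \<in> {degree M v, degree M' v}" if "v \<noteq> w" for v
    using ws(3)[of v] t dg[of v] that by (cases "v = t") auto
  have 3: "odd (?d v) \<longleftrightarrow> (odd (degree M v) \<longleftrightarrow> ((v = x) \<longleftrightarrow> (v = w)))" for v
    using ws(5)[of v] dg[of v] assms(5) by (cases "v = t"; cases "v = w") auto
  have 4: "M \<inter> M' \<subseteq> insert {t, w} N" "insert {t, w} N \<subseteq> M \<union> M'" using ws(1,2) assms(6) by auto
  show ?thesis unfolding walk_state_def using 1 2 3 4 by (intro conjI allI impI)
qed

lemma walk_state_remove:
  assumes "\<And>v. degree M v \<le> 2" "\<And>v. degree M' v \<le> 2"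
    and "walk_state M M' x N t" "finite N" "t \<noteq> w" "{t, w} \<in> N - M'" "degree N t > degree M' t"
  shows "walk_state M M' x (N - {{t, w}}) w"
proof -
  note ws = walk_stateD[OF assms(3)]
  let ?d = "degree (N - {{t, w}})"
  have dg: "degree N v = ?d v + of_bool (v = t \<or> v = w)" for v
    using degree_remove[of N "{t, w}" v] assms by simp
  have t: "?d t = degree M t \<or> ?d t = degree M' t" using ws(4) assms(7) dg[of t] by auto
  have w: "degree N w = degree M w \<or> degree N w = degree M' w" using ws(3) assms(5) by metis
  have "degree M w = 0 \<or> degree M w = 1 \<or> degree M w = 2" using assms(1)[of w] by linarith
  moreover have "degree M' w = 0 \<or> degree M' w = 1 \<or> degree M' w = 2"
    using assms(2)[of w] by linarith
  ultimately have 1: "?d w = degree M' w \<or>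
      ?d w < degree M' w \<and> Suc (?d w) \<in> {degree M w, degree M' w} \<or>
      ?d w > degree M' w \<and> ?d w - 1 \<in> {degree M w, degree M' w}"
    using w dg[of w] by auto
  have 2: "?d v \<in> {degree M v, degree M' v}" if "v \<noteq> w" for v
    using ws(3)[of v] t dg[of v] that by (cases "v = t") auto
  have 3: "odd (?d v) \<longleftrightarrow> (odd (degree M v) \<longleftrightarrow> ((v = x) \<longleftrightarrow> (v = w)))" for v
    using ws(5)[of v] dg[of v] assms(5) by (cases "v = t"; cases "v = w") auto
  have 4: "M \<inter> M' \<subseteq> N - {{t, w}}" "N - {{t, w}} \<subseteq> M \<union> M'" using ws(1,2) assms(6) by auto
  show ?thesis unfolding walk_state_def using 1 2 3 4 by (intro conjI allI impI)
qed

text \<open>At \<open>x\<close> the invariant would make the parities of \<open>M\<close> and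
  \<open>M'\<close> agree. At any other end vertex \<open>N\<close> has the parity of
  \<open>M'\<close> and not that of \<open>M\<close>. So a walk always joins two vertices of
  differing parity.\<close>

lemma walk_state_end:
  assumes "walk_state M M' x N t" "degree N t = degree M' t" "odd (degree M x) \<noteq> odd (degree M' x)"
  shows "t \<noteq> x" "odd (degree M t) \<noteq> odd (degree M' t)"
proof -
  have *: "odd (degree M' t) \<longleftrightarrow> (odd (degree M t) \<longleftrightarrow> t = x)"
    using walk_stateD(5)[OF assms(1), of t] assms(2) by simp
  with assms(3) show "t \<noteq> x" by blast
  with * show "odd (degree M t) \<noteq> odd (degree M' t)" by blast
qed

text \<open>With only two parity differences the far end of the walk is forced. The free invariant
  \<open>Q\<close> lets later arguments control the edge sets met on the way.\<close>

lemma directed_walk: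
  assumes "finite M" "finite M'" "\<And>e. e \<in> M \<union> M' \<Longrightarrow> card e = 2"
    and d: "\<And>v. degree M v \<le> 2" "\<And>v. degree M' v \<le> 2"
    and xs: "x \<noteq> s" "\<And>v. odd (degree M v) \<noteq> odd (degree M' v) \<longleftrightarrow> v = x \<or> v = s"
    and "Q M x"
    and "\<And>N t w. Q N t \<Longrightarrow> finite N \<Longrightarrow> t \<noteq> w \<Longrightarrow> {t, w} \<in> M' - N \<Longrightarrow> degree N t < degree M' t
           \<Longrightarrow> Q (insert {t, w} N) w"
    and "\<And>N t w. Q N t \<Longrightarrow> finite N \<Longrightarrow> t \<noteq> w \<Longrightarrow> {t, w} \<in> N - M' \<Longrightarrow> degree N t > degree M' t
           \<Longrightarrow> Q (N - {{t, w}}) w"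
  shows "\<exists>N. Q N s \<and> degree N s = degree M' s"
proof -
  have x: "odd (degree M x) \<noteq> odd (degree M' x)" using xs by blast
  have "\<exists>N t. (walk_state M M' x N t \<and> Q N t) \<and> degree N t = degree M' t"
  proof (rule alternating_walk[where M = M and x = x and Q = "\<lambda>N t. walk_state M M' x N t \<and> Q N t"])
    show "walk_state M M' x M x \<and> Q M x" using walk_state_init[OF d(1) d(2) x] assms(8) by simp
  next
    fix N t w
    assume "walk_state M M' x N t \<and> Q N t" "finite N" "t \<noteq> w" "{t, w} \<in> M' - N"
      "degree N t < degree M' t"
    then show "walk_state M M' x (insert {t, w} N) w \<and> Q (insert {t, w} N) w"
      by (intro conjI walk_state_insert[OF d] assms(9)) auto
  next
    fix N t w
    assume "walk_state M M' x N t \<and> Q N t" "finite N" "t \<noteq> w" "{t, w} \<in> N - M'"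
      "degree N t > degree M' t"
    then show "walk_state M M' x (N - {{t, w}}) w \<and> Q (N - {{t, w}}) w"
      by (intro conjI walk_state_remove[OF d] assms(10)) auto
  qed (use assms(1-3) in auto)
  then obtain N t where N: "walk_state M M' x N t" "Q N t" "degree N t = degree M' t" by blast
  have "t = s" using walk_state_end[OF N(1,3) x] xs(2) by blast
  with N show ?thesis by blast
qed

text \<open>The final edge set \<open>N\<close> of a walk and its complement \<open>N'\<close>
  redistribute the edges of \<open>M\<close> and \<open>M'\<close>, counted with multiplicity, so
  degrees still add up vertex by vertex. One half later provides the exchange, the other contradicts
  minimality.\<close>

lemma symmetric_exchange:
  assumes fin: "finite M" "finite M'" and "\<And>e. e \<in> M \<union> M' \<Longrightarrow> card e = 2"
    and d: "\<And>v. degree M v \<le> 2" "\<And>v. degree M' v \<le> 2"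
    and x: "odd (degree M x) \<noteq> odd (degree M' x)"
  obtains N N' t where "t \<noteq> x" "odd (degree M t) \<noteq> odd (degree M' t)"
    "N \<subseteq> M \<union> M'" "N' \<subseteq> M \<union> M'"
    "\<And>v. degree N v \<in> {degree M v, degree M' v}"
    "\<And>v. degree N' v \<in> {degree M v, degree M' v}"
    "\<And>v. odd (degree N v) \<longleftrightarrow> odd (degree M v) \<noteq> (v = x \<or> v = t)"
    "\<And>v. odd (degree N' v) \<longleftrightarrow> odd (degree M' v) \<noteq> (v = x \<or> v = t)"
proof -
  have "\<exists>N t. walk_state M M' x N t \<and> degree N t = degree M' t"
  proof (rule alternating_walk[where M = M and x = x and Q = "walk_state M M' x"])
    show "walk_state M M' x M x" by (rule walk_state_init[OF d(1) d(2) x])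
  next
    fix N t w
    assume "walk_state M M' x N t" "finite N" "t \<noteq> w" "{t, w} \<in> M' - N" "degree N t < degree M' t"
    then show "walk_state M M' x (insert {t, w} N) w" by (rule walk_state_insert[OF d])
  next
    fix N t w
    assume "walk_state M M' x N t" "finite N" "t \<noteq> w" "{t, w} \<in> N - M'" "degree N t > degree M' t"
    then show "walk_state M M' x (N - {{t, w}}) w" by (rule walk_state_remove[OF d])
  qed (use assms(1-3) in auto)
  then obtain N t where N: "walk_state M M' x N t" "degree N t = degree M' t" by blast
  note ws = walk_stateD[OF N(1)]
  note te = walk_state_end[OF N x]
  define N' where "N' = (M \<union> M' - N) \<union> (M \<inter> M')"
  have finN: "finite N" using ws(2) fin by (meson finite_UnI finite_subset)
  have finN': "finite N'" using fin by (simp add: N'_def)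
  have dN: "degree N v \<in> {degree M v, degree M' v}" for v using ws(3)[of v] N(2) by (cases "v = t") auto
  have sum: "degree N v + degree N' v = degree M v + degree M' v" for v
  proof -
    have *: "degree X v + degree Y v = degree (X \<union> Y) v + degree (X \<inter> Y) v"
      if "finite X" "finite Y" for X Y
    proof -
      have "{e \<in> X \<union> Y. v \<in> e} = {e \<in> X. v \<in> e} \<union> {e \<in> Y. v \<in> e}"
        "{e \<in> X \<inter> Y. v \<in> e} = {e \<in> X. v \<in> e} \<inter> {e \<in> Y. v \<in> e}" by auto
      then show ?thesis unfolding degree_def using card_Un_Int[of "{e \<in> X. v \<in> e}" "{e \<in> Y. v \<in> e}"] that by simp
    qed
    have "N \<union> N' = M \<union> M'" "N \<inter> N' = M \<inter> M'" using ws(1,2) by (auto simp: N'_def)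
    then show ?thesis using *[OF finN finN'] *[OF fin] by simp
  qed
  have dN': "degree N' v \<in> {degree M v, degree M' v}" for v using dN[of v] sum[of v] by auto
  have oN: "odd (degree N v) \<longleftrightarrow> odd (degree M v) \<noteq> (v = x \<or> v = t)" for v
    using ws(5)[of v] te(1) by auto
  have oN': "odd (degree N' v) \<longleftrightarrow> odd (degree M' v) \<noteq> (v = x \<or> v = t)" for v
  proof -
    have "odd (degree N v) = odd (degree N' v) \<longleftrightarrow> odd (degree M v) = odd (degree M' v)"
      using arg_cong[OF sum[of v], of even] by simp
    with oN[of v] show ?thesis by blast
  qed
  have sub: "N \<subseteq> M \<union> M'" "N' \<subseteq> M \<union> M'" using ws(2) by (auto simp: N'_def)
  show ?thesis by (rule that[of t N N']) (fact te sub dN dN' oN oN')+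
qed

subsection \<open>Edge sets with the fewest odd vertices\<close>

locale two_factor_graph =
  fixes A :: "'v set" and E :: "'v set set"
  assumes finite_A: "finite A" and finite_E: "finite E"
    and edge_cases: "e \<in> E \<Longrightarrow> \<exists>a\<in>A. \<exists>b. b \<notin> A \<and> e = {a, b}"
begin

definition legit :: "'v set set \<Rightarrow> bool" where
  "legit M \<longleftrightarrow> M \<subseteq> E \<and> (\<forall>a\<in>A. degree M a = 2) \<and> (\<forall>b. b \<notin> A \<longrightarrow> degree M b \<le> 2)"

lemma card_edge: "e \<in> E \<Longrightarrow> card e = 2"
  using edge_cases by (fastforce simp: card_2_iff)

lemma edge_neq: "{u, v} \<in> E \<Longrightarrow> u \<noteq> v"
  using card_edge by fastforce

lemma other_end:
  assumes "e \<in> E" "v \<in> e"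
  shows "\<exists>w. e = {v, w} \<and> v \<noteq> w"
proof -
  obtain x y where "e = {x, y}" "x \<noteq> y" using card_edge[OF assms(1)] by (auto simp: card_2_iff)
  then show ?thesis using assms(2) by (cases "v = x") auto
qed

lemma edge_sides: "{u, v} \<in> E \<Longrightarrow> u \<in> A \<longleftrightarrow> v \<notin> A"
  using edge_cases[of "{u, v}"] by (auto simp: doubleton_eq_iff)

lemma finite_sub: "M \<subseteq> E \<Longrightarrow> finite M"
  using finite_E finite_subset by blast

lemma legitD:
  assumes "legit M"
  shows "M \<subseteq> E" "finite M" "a \<in> A \<Longrightarrow> degree M a = 2" "b \<notin> A \<Longrightarrow> degree M b \<le> 2" "degree M v \<le> 2"
  using assms finite_sub unfolding legit_def by (auto, metis order_refl)

lemma finite_odd: "M \<subseteq> E \<Longrightarrow> finite (odd_verts M)"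
  using finite_odd_verts[of M] finite_sub card_edge by blast

lemma even_odd: "M \<subseteq> E \<Longrightarrow> even (card (odd_verts M))"
  using handshake[of M] finite_sub card_edge by blast

lemma odd_vert_legit:
  assumes "legit M" "b \<in> odd_verts M"
  shows "b \<notin> A" "degree M b = 1"
proof -
  have "odd (degree M b)" using assms by (simp add: mem_odd_verts)
  moreover from this have "degree M b \<noteq> 2" by (intro notI) simp
  moreover have "degree M b \<le> 2" using legitD(5)[OF assms(1)] .
  ultimately show "degree M b = 1" by (cases "degree M b = 0") auto
  show "b \<notin> A" using legitD(3)[OF assms(1)] \<open>degree M b \<noteq> 2\<close> by blast
qed

end

locale odd_bound = two_factor_graph A E for A :: "'v set" and E +
  fixes \<nu> :: nat
  assumes nu_le: "legit M \<Longrightarrow> \<nu> \<le> card (odd_verts M)"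
    and nu_pos: "\<nu> > 0"
begin

definition opt :: "'v set set \<Rightarrow> bool" where
  "opt M \<longleftrightarrow> legit M \<and> card (odd_verts M) = \<nu>"

text \<open>In a good state \<open>(M, t)\<close> only the token \<open>t\<close> may violate the degree constraints, by one unit,
  and the violation is paid for by one odd vertex less elsewhere.\<close>

definition good :: "'v set set \<Rightarrow> 'v \<Rightarrow> bool" where
  "good M t \<longleftrightarrow> M \<subseteq> E \<and> (\<forall>a\<in>A. a \<noteq> t \<longrightarrow> degree M a = 2) \<and>
     (\<forall>b. b \<notin> A \<longrightarrow> b \<noteq> t \<longrightarrow> degree M b \<le> 2) \<and> degree M t \<in> {1, 3} \<and>
     Suc (card (odd_verts M - {t})) = \<nu>"

lemma optD: "opt M \<Longrightarrow> legit M" "opt M \<Longrightarrow> card (odd_verts M) = \<nu>"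
  by (auto simp: opt_def)

lemma goodD:
  assumes "good M t"
  shows "M \<subseteq> E" "finite M" "a \<in> A \<Longrightarrow> a \<noteq> t \<Longrightarrow> degree M a = 2"
    "b \<notin> A \<Longrightarrow> b \<noteq> t \<Longrightarrow> degree M b \<le> 2" "degree M t = 1 \<or> degree M t = 3"
    "Suc (card (odd_verts M - {t})) = \<nu>"
  using assms finite_sub unfolding good_def by auto

lemma opt_good:
  assumes "opt M" "x \<in> odd_verts M"
  shows "good M x"
proof -
  have "legit M" "card (odd_verts M) = \<nu>" using assms optD by auto
  moreover have "Suc (card (odd_verts M - {x})) = card (odd_verts M)"
    using assms finite_odd legitD(1)[OF \<open>legit M\<close>] by (metis card_Suc_Diff1)
  ultimately show ?thesis using legitD[of M] odd_vert_legit[of M x] assms unfolding good_def by auto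
qed

lemma good_opt:
  assumes "good M x" "x \<notin> A" "degree M x = 1"
  shows "opt M" "x \<in> odd_verts M"
proof -
  show x: "x \<in> odd_verts M" using assms by (simp add: mem_odd_verts)
  then have "Suc (card (odd_verts M - {x})) = card (odd_verts M)"
    using finite_odd goodD(1)[OF assms(1)] by (metis card_Suc_Diff1)
  moreover have "legit M" unfolding legit_def
    using goodD[OF assms(1)] assms(2,3) by (metis one_le_numeral)
  ultimately show "opt M" unfolding opt_def using goodD(6)[OF assms(1)] by linarith
qed

text \<open>Minimality enters here. If the token moved onto an odd vertex, both ends of the flipped
  edge would become even and a legit edge set with fewer than \<open>\<nu>\<close> odd vertices
  would result. So a token only moves to even vertices, and the state stays good.\<close>

lemma flip_aux:
  assumes g: "good M t" and M1: "M1 \<subseteq> E" and tw: "t \<noteq> w"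
    and dv: "\<And>v. v \<noteq> t \<Longrightarrow> v \<noteq> w \<Longrightarrow> degree M1 v = degree M v"
    and dt: "even (degree M1 t)" "degree M1 t \<le> 2" "t \<in> A \<Longrightarrow> degree M1 t = 2"
    and dw: "degree M1 w = Suc (degree M w) \<or> degree M w = Suc (degree M1 w)"
  shows "w \<notin> odd_verts M" "good M1 w"
proof -
  have w2: "degree M w \<le> 2" "w \<in> A \<Longrightarrow> degree M w = 2" using goodD(3,4)[OF g, of w] tw by (cases "w \<in> A"; auto)+
  have other: "v \<in> odd_verts M1 \<longleftrightarrow> v \<in> odd_verts M" if "v \<noteq> t" "v \<noteq> w" for v
    using dv[OF that] by (simp add: mem_odd_verts)
  have t: "t \<notin> odd_verts M1" using dt by (simp add: mem_odd_verts)
  have wodd: "w \<in> odd_verts M1 \<longleftrightarrow> w \<notin> odd_verts M"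
    using dw by (auto simp: mem_odd_verts)
  have fin: "finite (odd_verts M)" using finite_odd goodD(1)[OF g] .
  show w: "w \<notin> odd_verts M"
  proof
    assume w: "w \<in> odd_verts M"
    then have "odd (degree M w)" by (simp add: mem_odd_verts)
    then have "degree M w \<noteq> 2" "degree M w \<noteq> 0" by (intro notI; simp)+
    then have w1: "degree M w = 1" "w \<notin> A" using w2 by auto
    have "legit M1" unfolding legit_def
    proof (intro conjI ballI allI impI M1)
      fix a assume a: "a \<in> A"
      show "degree M1 a = 2" 
        using a w1(2) dt(3) dv[of a] goodD(3)[OF g, of a] by (cases "a = t") auto
    next
      fix b assume b: "b \<notin> A"
      show "degree M1 b \<le> 2"
        using b w1 dw dt(2) dv[of b] goodD(4)[OF g, of b] by (cases "b = t"; cases "b = w") auto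
    qed
    moreover have "odd_verts M1 \<subseteq> odd_verts M - {t} - {w}"
    proof
      fix v assume "v \<in> odd_verts M1"
      then show "v \<in> odd_verts M - {t} - {w}" using other[of v] t wodd w by (cases "v = w") auto
    qed
    then have "card (odd_verts M1) \<le> card (odd_verts M - {t} - {w})"
      using fin by (intro card_mono) auto
    moreover have "card (odd_verts M - {t} - {w}) < card (odd_verts M - {t})"
      using fin w tw by (intro card_Diff1_less) auto
    ultimately show False using nu_le[of M1] goodD(6)[OF g] by simp
  qed
  have eq: "odd_verts M1 - {w} = odd_verts M - {t}" 
  proof (rule set_eqI)
    fix v
    show "v \<in> odd_verts M1 - {w} \<longleftrightarrow> v \<in> odd_verts M - {t}"
      using other[of v] t wodd w tw by (cases "v = w"; cases "v = t") auto
  qed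
  have "even (degree M w)" using w by (simp add: mem_odd_verts)
  then have "degree M w = 0 \<or> degree M w = 2" using w2(1) by (cases "degree M w = 1") auto
  then have "degree M1 w \<in> {1, 3}" using dw by auto
  then show "good M1 w" unfolding good_def eq
    using M1 goodD(6)[OF g] dv dt goodD(3,4)[OF g] by metis
qed

lemma good_insert:
  assumes "good M t" "{t, w} \<in> E" "{t, w} \<notin> M" "degree M t = 1"
  shows "good (insert {t, w} M) w" "w \<notin> odd_verts M"
proof -
  have tw: "t \<noteq> w" using edge_neq assms(2) .
  have dg: "degree (insert {t, w} M) v = degree M v + of_bool (v = t \<or> v = w)" for v
    using degree_insert[of M "{t, w}" v] assms(3) goodD(2)[OF assms(1)] by simp
  have 1: "insert {t, w} M \<subseteq> E" using goodD(1)[OF assms(1)] assms(2) by auto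
  have 2: "degree (insert {t, w} M) v = degree M v" if "v \<noteq> t" "v \<noteq> w" for v using that by (simp add: dg)
  have 3: "even (degree (insert {t, w} M) t)" "degree (insert {t, w} M) t \<le> 2"
    "degree (insert {t, w} M) t = 2"
    using assms(4) by (simp_all add: dg)
  have 5: "degree (insert {t, w} M) w = Suc (degree M w) \<or> degree M w = Suc (degree (insert {t, w} M) w)"
    by (simp add: dg)
  show "w \<notin> odd_verts M" "good (insert {t, w} M) w"
    by (rule flip_aux[OF assms(1) 1 tw 2 3 5]; simp)+
qed

text \<open>Outside \<open>A\<close> the token may leave by a deletion even at degree 1, because
  degree 0 is allowed there; in \<open>A\<close> only degree 3 may drop.\<close>

lemma good_remove:
  assumes "good M t" "{t, w} \<in> M" "degree M t = 3 \<or> t \<notin> A"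
  shows "good (M - {{t, w}}) w" "w \<notin> odd_verts M"
proof -
  have tw: "t \<noteq> w" using edge_neq assms(2) goodD(1)[OF assms(1)] by blast
  have dg: "degree M v = degree (M - {{t, w}}) v + of_bool (v = t \<or> v = w)" for v
    using degree_remove[of M "{t, w}" v] assms(2) goodD(2)[OF assms(1)] by simp
  have dt: "degree M t = Suc (degree (M - {{t, w}}) t)" using dg[of t] by simp
  have 1: "M - {{t, w}} \<subseteq> E" using goodD(1)[OF assms(1)] by auto
  have 2: "degree (M - {{t, w}}) v = degree M v" if "v \<noteq> t" "v \<noteq> w" for v using dg[of v] that by simp
  have 3: "even (degree (M - {{t, w}}) t)" "degree (M - {{t, w}}) t \<le> 2"
    using dt goodD(5)[OF assms(1)] by auto
  have 4: "degree (M - {{t, w}}) t = 2" if "t \<in> A" using assms(3) dt that by auto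
  have 5: "degree (M - {{t, w}}) w = Suc (degree M w) \<or> degree M w = Suc (degree (M - {{t, w}}) w)"
    using dg[of w] by simp
  show "w \<notin> odd_verts M" "good (M - {{t, w}}) w"
    by (rule flip_aux[OF assms(1) 1 tw 2 3 4 5]; simp)+
qed

text \<open>This is basis exchange for the odd sets of optimal edge sets. A walk from
  \<open>s\<close> toggles its two ends in both odd sets. If the far end \<open>x\<close> were odd
  in \<open>M'\<close>, the complementary edge set would have two odd vertices fewer than
  \<open>M'\<close>.\<close>

lemma opt_exchange:
  assumes "opt M" "opt M'" "s \<in> odd_verts M' - odd_verts M"
  shows "\<exists>N x. x \<in> odd_verts M - odd_verts M' \<and> opt N \<and>
    odd_verts N = insert s (odd_verts M - {x})"
proof -
  have l: "legit M" "legit M'" using assms optD by auto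
  have fin: "finite M" "finite M'" using l legitD by auto
  have c2: "card e = 2" if "e \<in> M \<union> M'" for e using that l legitD(1) card_edge by blast
  have s: "odd (degree M s) \<noteq> odd (degree M' s)" using assms(3) by (simp add: mem_odd_verts)
  obtain N N' x where x: "x \<noteq> s" "odd (degree M x) \<noteq> odd (degree M' x)"
    and sub: "N \<subseteq> M \<union> M'" "N' \<subseteq> M \<union> M'"
    and d: "\<And>v. degree N v \<in> {degree M v, degree M' v}"
    "\<And>v. degree N' v \<in> {degree M v, degree M' v}"
    and o: "\<And>v. odd (degree N v) \<longleftrightarrow> odd (degree M v) \<noteq> (v = s \<or> v = x)"
    "\<And>v. odd (degree N' v) \<longleftrightarrow> odd (degree M' v) \<noteq> (v = s \<or> v = x)"
    by (rule symmetric_exchange[OF fin c2 legitD(5)[OF l(1)] legitD(5)[OF l(2)] s])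
      (assumption | rule that)+
  have lN: "legit N" if "N \<subseteq> M \<union> M'" "\<And>v. degree N v \<in> {degree M v, degree M' v}" for N
    unfolding legit_def
  proof (intro conjI ballI allI impI)
    show "N \<subseteq> E" using that(1) l legitD(1) by blast
    show "degree N a = 2" if "a \<in> A" for a
      using \<open>degree N a \<in> _\<close> legitD(3)[OF l(1) that] legitD(3)[OF l(2) that] by auto
    show "degree N b \<le> 2" for b
      using \<open>degree N b \<in> _\<close> legitD(5)[OF l(1), of b] legitD(5)[OF l(2), of b] by auto
  qed
  have f: "finite (odd_verts M)" "finite (odd_verts M')" using l legitD(1) finite_odd by auto
  have xM: "x \<in> odd_verts M - odd_verts M'"
  proof (rule ccontr)
    assume "\<not> ?thesis"
    with x(2) have x': "x \<in> odd_verts M'" by (auto simp: mem_odd_verts)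
    have "odd_verts N' = odd_verts M' - {s} - {x}"
    proof (rule set_eqI)
      fix v
      show "v \<in> odd_verts N' \<longleftrightarrow> v \<in> odd_verts M' - {s} - {x}"
        using o(2)[of v] x' assms(3) unfolding mem_odd_verts Diff_iff by blast
    qed
    then have "odd_verts N' \<subset> odd_verts M'" using x' by blast
    then have "card (odd_verts N') < card (odd_verts M')" using f(2) by (rule psubset_card_mono[rotated])
    with nu_le[OF lN[OF sub(2) d(2)]] optD(2)[OF assms(2)] show False by simp
  qed
  have oN: "odd_verts N = insert s (odd_verts M - {x})"
  proof (rule set_eqI)
    fix v
    show "v \<in> odd_verts N \<longleftrightarrow> v \<in> insert s (odd_verts M - {x})"
      using o(1)[of v] xM assms(3) x(1) unfolding mem_odd_verts Diff_iff insert_iff by blast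
  qed
  have "card (odd_verts N) = card (odd_verts M)"
    unfolding oN using xM assms(3) f(1) by (metis Diff_iff card.remove card_insert_disjoint finite_Diff)
  then have "opt N" using lN[OF sub(1) d(1)] optD(2)[OF assms(1)] by (simp add: opt_def)
  with xM oN show ?thesis by blast
qed

text \<open>The ends \<open>x\<close> and \<open>s\<close> of the walk towards \<open>M'\<close> are
  forced, and good states persist along it. The invariant \<open>Q\<close> serves to protect a
  vertex or an edge; a vertex that stays odd is never entered, by
  \<open>w \<notin> odd_verts N\<close>.\<close>

lemma good_walk:
  assumes "opt M" "opt M'" "x \<in> odd_verts M" "s \<notin> odd_verts M"
    and odd: "odd_verts M' = insert s (odd_verts M - {x})"
    and "Q M x"
    and step: "\<And>N N' t w. good N t \<Longrightarrow> Q N t \<Longrightarrow> good N' w \<Longrightarrow> {t, w} \<in> E \<Longrightarrow> w \<notin> odd_verts N \<Longrightarrow>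
      N' = insert {t, w} N \<and> {t, w} \<notin> N \<and> degree N t < 2 \<or> N' = N - {{t, w}} \<and> {t, w} \<in> N \<Longrightarrow> Q N' w"
  obtains N where "opt N" "s \<in> odd_verts N" "Q N s"
proof -
  have l: "legit M" "legit M'" using assms optD by auto
  have fin: "finite M" "finite M'" using l legitD by auto
  have c2: "card e = 2" if "e \<in> M \<union> M'" for e using that l legitD(1) card_edge by blast
  have s': "s \<in> odd_verts M'" using odd by simp
  have "\<exists>N. (good N s \<and> Q N s) \<and> degree N s = degree M' s"
  proof (rule directed_walk[where M = M and x = x and Q = "\<lambda>N t. good N t \<and> Q N t", OF fin c2
        legitD(5)[OF l(1)] legitD(5)[OF l(2)]])
    show "x \<noteq> s" using assms by blast
    show "odd (degree M v) \<noteq> odd (degree M' v) \<longleftrightarrow> v = x \<or> v = s" for v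
    proof -
      have "v \<in> odd_verts M \<and> v \<notin> odd_verts M' \<or> v \<notin> odd_verts M \<and> v \<in> odd_verts M' \<longleftrightarrow> v = x \<or> v = s"
        using assms(3,4) odd by auto
      then show ?thesis by (auto simp: mem_odd_verts)
    qed
    show "good M x \<and> Q M x" using opt_good assms by blast
  next
    fix N t w
    assume *: "good N t \<and> Q N t" "finite N" "t \<noteq> w" "{t, w} \<in> M' - N" "degree N t < degree M' t"
    have E: "{t, w} \<in> E" using * legitD(1)[OF l(2)] by blast
    have lt: "degree N t < 2" using * legitD(5)[OF l(2), of t] by linarith
    then have 1: "degree N t = 1" using * goodD(5)[of N t] by auto
    have g: "good (insert {t, w} N) w" "w \<notin> odd_verts N" using good_insert[of N t w] * E 1 by auto
    show "good (insert {t, w} N) w \<and> Q (insert {t, w} N) w"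
      using step[of N t "insert {t, w} N" w] g E * lt by auto
  next
    fix N t w
    assume *: "good N t \<and> Q N t" "finite N" "t \<noteq> w" "{t, w} \<in> N - M'" "degree N t > degree M' t"
    have E: "{t, w} \<in> E" using * goodD(1)[of N t] by blast
    have 3: "degree N t = 3 \<or> t \<notin> A" using * goodD(5)[of N t] legitD(3)[OF l(2), of t] by auto
    have g: "good (N - {{t, w}}) w" "w \<notin> odd_verts N" using good_remove[of N t w] * E 3 by auto
    show "good (N - {{t, w}}) w \<and> Q (N - {{t, w}}) w"
      using step[of N t "N - {{t, w}}" w] g E * by auto
  qed
  then obtain N where N: "good N s" "Q N s" "degree N s = degree M' s" by blast
  have "s \<notin> A" "degree N s = 1" using odd_vert_legit[OF l(2) s'] N(3) by auto
  then show ?thesis using good_opt[OF N(1)] that N(2) by blast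
qed

section \<open>The matroid of odd sets\<close>

definition reach :: "'v set" where
  "reach = (\<Union>M\<in>Collect opt. odd_verts M)"

text \<open>By \<open>opt_exchange\<close> the odd sets of optimal edge sets behave like the bases
  of a matroid: \<open>reach\<close> consists of its non-loops, and \<open>par\<close> is
  parallelism.\<close>

definition par :: "'v \<Rightarrow> 'v \<Rightarrow> bool" where
  "par b c \<longleftrightarrow> b = c \<or> \<not> (\<exists>M. opt M \<and> b \<in> odd_verts M \<and> c \<in> odd_verts M)"

lemma reachI: "opt M \<Longrightarrow> b \<in> odd_verts M \<Longrightarrow> b \<in> reach"
  by (auto simp: reach_def)

lemma reachI_good: "good M b \<Longrightarrow> b \<notin> A \<Longrightarrow> degree M b = 1 \<Longrightarrow> b \<in> reach"
  using good_opt reachI by blast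

lemma par_sym: "par b c \<Longrightarrow> par c b"
  by (auto simp: par_def)

text \<open>Exchanging \<open>b2\<close> into a basis that contains \<open>b1\<close> and
  \<open>b3\<close> expels at most one of them, and \<open>b2\<close> then shares a basis with the
  other.\<close>

lemma par_trans:
  assumes "b2 \<in> reach" "par b1 b2" "par b2 b3"
  shows "par b1 b3"
proof (rule ccontr)
  assume "\<not> par b1 b3"
  then obtain M where M: "opt M" "b1 \<in> odd_verts M" "b3 \<in> odd_verts M" "b1 \<noteq> b3"
    by (auto simp: par_def)
  have n: "b1 \<noteq> b2" "b2 \<noteq> b3" using \<open>\<not> par b1 b3\<close> assms by auto
  obtain M' where M': "opt M'" "b2 \<in> odd_verts M'" using assms(1) by (auto simp: reach_def)
  have "b2 \<notin> odd_verts M" using M n assms(2) by (auto simp: par_def)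
  then have b2: "b2 \<in> odd_verts M' - odd_verts M" using M'(2) by blast
  obtain N x where N: "opt N" "odd_verts N = insert b2 (odd_verts M - {x})"
    using opt_exchange[OF M(1) M'(1) b2] by blast
  then have "b2 \<in> odd_verts N" "b1 \<in> odd_verts N \<or> b3 \<in> odd_verts N" using M(2-4) by auto
  with N(1) n assms(2,3) show False by (auto simp: par_def)
qed

end

subsection \<open>Graphs without essential vertices\<close>

text \<open>The last two assumptions say that no vertex is essential: deleting it does not raise the minimal
  number of odd vertices.\<close>

locale critical_graph = odd_bound A E \<nu> for A :: "'v set" and E and \<nu> +
  fixes p :: "'v \<Rightarrow> bool \<Rightarrow> 'v"
  assumes pend_edge: "a \<in> A \<Longrightarrow> {a, p a i} \<in> E"
    and pend_only: "a \<in> A \<Longrightarrow> e \<in> E \<Longrightarrow> p a i \<in> e \<Longrightarrow> e = {a, p a i}"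
    and pend_neq: "a \<in> A \<Longrightarrow> p a True \<noteq> p a False"
    and ex_opt: "\<exists>M. opt M"
    and avoid_optional: "b \<notin> A \<Longrightarrow> (\<And>a i. a \<in> A \<Longrightarrow> b \<noteq> p a i) \<Longrightarrow> \<exists>M. opt M \<and> degree M b = 0"
    and avoid_required: "a \<in> A \<Longrightarrow> \<exists>M\<subseteq>E. degree M a = 0 \<and> (\<forall>a'\<in>A. a' \<noteq> a \<longrightarrow> degree M a' = 2) \<and>
      (\<forall>b. b \<notin> A \<longrightarrow> degree M b \<le> 2) \<and> card (odd_verts M) \<le> \<nu>"
begin

section \<open>Tokens on vertices of \<open>A\<close> in a critical graph\<close>

definition under :: "'v set" where
  "under = {a \<in> A. \<exists>M. good M a \<and> degree M a = 1}"

definition over :: "'v set" where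
  "over = {a \<in> A. \<exists>M. good M a \<and> degree M a = 3}"

lemma pend_notin: "a \<in> A \<Longrightarrow> p a i \<notin> A"
  using edge_sides pend_edge by blast

lemma pend_degree:
  assumes "a \<in> A" "M \<subseteq> E"
  shows "degree M (p a i) = of_bool ({a, p a i} \<in> M)"
proof -
  have "{e \<in> M. p a i \<in> e} = (if {a, p a i} \<in> M then {{a, p a i}} else {})"
    using pend_only[OF assms(1)] assms(2) by auto
  then show ?thesis by (simp add: degree_def)
qed

lemma pend_odd: "a \<in> A \<Longrightarrow> M \<subseteq> E \<Longrightarrow> p a i \<in> odd_verts M \<longleftrightarrow> {a, p a i} \<in> M"
  by (simp add: mem_odd_verts pend_degree)

lemma reach_notin: "b \<in> reach \<Longrightarrow> b \<notin> A"
  unfolding reach_def using odd_vert_legit(1) optD(1) by blast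

lemma opt_remove:
  assumes "opt M" "s \<in> odd_verts M" "{a, s} \<in> M"
  shows "good (M - {{a, s}}) a" "degree (M - {{a, s}}) a = 1" "a \<in> under"
proof -
  have l: "legit M" using assms optD by blast
  have s: "s \<notin> A" using odd_vert_legit(1)[OF l assms(2)] .
  have "{a, s} \<in> E" using assms(3) legitD(1)[OF l] by blast
  then have a: "a \<in> A" using s edge_sides by blast
  show g: "good (M - {{a, s}}) a"
    using good_remove(1)[OF opt_good[OF assms(1,2)], of a] assms(3) s by (simp add: insert_commute)
  show d: "degree (M - {{a, s}}) a = 1"
    using degree_remove[OF legitD(2)[OF l] assms(3), of a] legitD(3)[OF l a] by simp
  show "a \<in> under" using a g d by (auto simp: under_def)
qed

text \<open>Deleting \<open>{a, s}\<close> puts the token on \<open>a\<close> with degree 1.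
  Inserting \<open>{a, c}\<close> would then move it onto the odd vertex \<open>c\<close>, which
  \<open>good_insert\<close> excludes.\<close>

lemma opt_swap:
  assumes "opt M" "s \<in> odd_verts M" "c \<in> odd_verts M" "s \<noteq> c" "{a, s} \<in> M" "{a, c} \<in> E"
  shows "{a, c} \<in> M"
proof (rule ccontr)
  assume n: "{a, c} \<notin> M"
  have l: "legit M" using assms optD by blast
  note r = opt_remove[OF assms(1,2,5)]
  have "c \<noteq> a" using assms(6) edge_neq by blast
  then have "degree (M - {{a, s}}) c = degree M c"
    using degree_remove[OF legitD(2)[OF l] assms(5), of c] assms(4) by simp
  moreover have "c \<notin> odd_verts (M - {{a, s}})" using good_insert(2)[OF r(1) assms(6) _ r(2)] n by blast
  ultimately show False using assms(3) by (simp add: mem_odd_verts)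
qed

lemma overI:
  assumes "opt M" "b \<in> odd_verts M" "{a, b} \<in> E" "{a, b} \<notin> M"
  shows "a \<in> over"
proof -
  have l: "legit M" using assms optD by blast
  have b: "b \<notin> A" "degree M b = 1" using odd_vert_legit[OF l assms(2)] .
  then have a: "a \<in> A" using assms(3) edge_sides by blast
  have "good (insert {b, a} M) a"
    using good_insert(1)[OF opt_good[OF assms(1,2)], of a] assms(3,4) b by (simp add: insert_commute)
  moreover have "degree (insert {b, a} M) a = 3"
    using degree_insert[OF legitD(2)[OF l], of "{b, a}" a] assms(4) legitD(3)[OF l a]
    by (simp add: insert_commute)
  ultimately show ?thesis using a by (auto simp: over_def)
qed

text \<open>Converse to \<open>overI\<close>: at degree 3 any edge may be dropped, and its other end
  becomes odd.\<close>

lemma over_witness: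
  assumes "a \<in> over"
  obtains M c where "opt M" "c \<in> odd_verts M" "{a, c} \<in> E" "{a, c} \<notin> M"
proof -
  obtain M where a: "a \<in> A" and M: "good M a" "degree M a = 3" using assms by (auto simp: over_def)
  have "\<exists>e\<in>M. a \<in> e" using degree_0_iff[OF goodD(2)[OF M(1)], of a] M(2) by simp
  then obtain e where e: "e \<in> M" "a \<in> e" by blast
  have eE: "e \<in> E" using e(1) goodD(1)[OF M(1)] by blast
  obtain c where c: "e = {a, c}" "a \<noteq> c" using other_end[OF eE e(2)] by blast
  have g: "good (M - {{a, c}}) c" using good_remove(1)[OF M(1)] e c M(2) by blast
  have cA: "c \<notin> A" using edge_sides a eE c(1) by blast
  have "degree (M - {{a, c}}) c < degree M c"
    using degree_remove[OF goodD(2)[OF M(1)], of e c] e(1) c by simp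
  then have "degree (M - {{a, c}}) c = 1" using goodD(4)[OF M(1) cA] c(2) goodD(5)[OF g] by auto
  then have "opt (M - {{a, c}})" "c \<in> odd_verts (M - {{a, c}})" using good_opt[OF g cA] by auto
  then show ?thesis using that eE c by blast
qed

text \<open>At degree 1 at most one of the two pendant edges of \<open>a\<close> is in use, so the
  token can leave through a free one.\<close>

lemma under_add_pendant:
  assumes "a \<in> A" "good M a" "degree M a = 1"
  obtains i where "{a, p a i} \<notin> M" "opt (insert {a, p a i} M)" "p a i \<in> odd_verts (insert {a, p a i} M)"
proof -
  have fin: "finite M" using goodD(2)[OF assms(2)] .
  have "\<exists>i. {a, p a i} \<notin> M"
  proof (rule ccontr)
    assume "\<nexists>i. {a, p a i} \<notin> M"
    then have "{{a, p a True}, {a, p a False}} \<subseteq> {e \<in> M. a \<in> e}" by blast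
    then have "card {{a, p a True}, {a, p a False}} \<le> degree M a"
      unfolding degree_def using fin by (intro card_mono) auto
    moreover have "{a, p a True} \<noteq> {a, p a False}" using pend_neq[OF assms(1)] by (metis doubleton_eq_iff)
    ultimately show False using assms(3) by simp
  qed
  then obtain i where i: "{a, p a i} \<notin> M" by blast
  have g: "good (insert {a, p a i} M) (p a i)"
    using good_insert(1)[OF assms(2) pend_edge[OF assms(1)] i assms(3)] .
  have "degree (insert {a, p a i} M) (p a i) = 1"
    using pend_degree[OF assms(1) goodD(1)[OF g], of i] by simp
  then show ?thesis using that[OF i] good_opt[OF g pend_notin[OF assms(1)]] by blast
qed

lemma under_pendant_reach:
  assumes "a \<in> under"
  shows "p a i \<in> reach"
proof -
  obtain M where a: "a \<in> A" and M: "good M a" "degree M a = 1" using assms by (auto simp: under_def)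
  show ?thesis
  proof (cases "{a, p a i} \<in> M")
    case True
    obtain j where j: "opt (insert {a, p a j} M)" using under_add_pendant[OF a M] by blast
    then have "p a i \<in> odd_verts (insert {a, p a j} M)"
      using pend_odd[OF a legitD(1)[OF optD(1)[OF j]], of i] True by simp
    then show ?thesis using reachI j by blast
  next
    case False
    have g: "good (insert {a, p a i} M) (p a i)"
      using good_insert(1)[OF M(1) pend_edge[OF a] False M(2)] .
    moreover have "degree (insert {a, p a i} M) (p a i) = 1"
      using pend_degree[OF a goodD(1)[OF g], of i] by simp
    ultimately show ?thesis using reachI_good pend_notin[OF a] by blast
  qed
qed

lemma degree_flip_other:
  assumes "finite N" "v \<noteq> t" "v \<noteq> w"
    and "N' = insert {t, w} N \<and> {t, w} \<notin> N \<or> N' = N - {{t, w}} \<and> {t, w} \<in> N"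
  shows "degree N' v = degree N v"
  using assms(4)
proof (elim disjE conjE)
  assume "N' = insert {t, w} N" "{t, w} \<notin> N"
  then show ?thesis using degree_insert[OF assms(1), of "{t, w}" v] assms(2,3) by simp
next
  assume "N' = N - {{t, w}}" "{t, w} \<in> N"
  then show ?thesis using degree_remove[OF assms(1), of "{t, w}" v] assms(2,3) by simp
qed

text \<open>If \<open>b\<close> were not in \<open>reach\<close>, it would not be a pendant, so some
  optimal edge set avoids it. A walk makes a pendant of \<open>a\<close> odd and never enters
  \<open>b\<close>, since arriving there from degree 0 would give degree 1 and put \<open>b\<close>
  in \<open>reach\<close>. Replacing the pendant edge by \<open>{a, b}\<close> finally makes
  \<open>b\<close> odd.\<close>

lemma under_neighbour_reach:
  assumes "a \<in> under" "{a, b} \<in> E"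
  shows "b \<in> reach"
proof (rule ccontr)
  assume nr: "b \<notin> reach"
  have a: "a \<in> A" using assms(1) by (simp add: under_def)
  have bA: "b \<notin> A" using a assms(2) edge_sides by blast
  have "b \<noteq> p a' i" if "a' \<in> A" for a' i
  proof
    assume b: "b = p a' i"
    then have "{a, b} = {a', p a' i}" using pend_only[OF that assms(2)] by blast
    then have "a = a'" using b a bA that by (auto simp: doubleton_eq_iff)
    with b nr under_pendant_reach[OF assms(1)] show False by blast
  qed
  then obtain M0 where M0: "opt M0" "degree M0 b = 0" using avoid_optional[OF bA] by blast
  let ?s = "p a True"
  obtain N where N: "opt N" "?s \<in> odd_verts N" "degree N b = 0"
  proof (cases "?s \<in> odd_verts M0")
    case True
    with M0 that show ?thesis by blast
  next
    case False
    obtain M' where M': "opt M'" "?s \<in> odd_verts M'"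
      using under_pendant_reach[OF assms(1), of True] by (auto simp: reach_def)
    have s: "?s \<in> odd_verts M' - odd_verts M0" using M'(2) False by blast
    obtain M2 x where M2: "x \<in> odd_verts M0 - odd_verts M'" "opt M2"
      "odd_verts M2 = insert ?s (odd_verts M0 - {x})"
      using opt_exchange[OF M0(1) M'(1) s] by blast
    show ?thesis
    proof (rule good_walk[OF M0(1) M2(2) _ False M2(3), where Q = "\<lambda>N t. degree N b = 0 \<and> t \<noteq> b"])
      show "x \<in> odd_verts M0" using M2(1) by blast
      then show "degree M0 b = 0 \<and> x \<noteq> b" using M0 by (auto simp: mem_odd_verts)
    next
      fix N N' t w
      assume *: "good N t" "degree N b = 0 \<and> t \<noteq> b" "good N' w" "{t, w} \<in> E"
        "N' = insert {t, w} N \<and> {t, w} \<notin> N \<and> degree N t < 2 \<or> N' = N - {{t, w}} \<and> {t, w} \<in> N"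
      have fin: "finite N" using goodD(2)[OF *(1)] .
      have "w \<noteq> b"
      proof
        assume w: "w = b"
        have "{t, b} \<notin> N" using degree_0_iff[OF fin] *(2) by blast
        then have "degree N' b = 1" using *(2,5) w degree_insert[OF fin, of "{t, b}" b] by auto
        then show False using reachI_good[of N' b] *(3) w bA nr by blast
      qed
      then show "degree N' b = 0 \<and> w \<noteq> b" using degree_flip_other[OF fin, of b t w N'] * by auto
    next
      fix N assume "opt N" "?s \<in> odd_verts N" "degree N b = 0 \<and> ?s \<noteq> b"
      then show ?thesis using that by blast
    qed
  qed
  have l: "legit N" using N optD by blast
  have as: "{a, ?s} \<in> N" using pend_odd[OF a legitD(1)[OF l]] N(2) by blast
  note r = opt_remove[OF N(1,2) as]
  have n: "{a, b} \<notin> N - {{a, ?s}}" using degree_0_iff[OF legitD(2)[OF l]] N(3) by blast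
  have g: "good (insert {a, b} (N - {{a, ?s}})) b" using good_insert(1)[OF r(1) assms(2) n r(2)] .
  have "degree (N - {{a, ?s}}) b = 0" using degree_mono[OF legitD(2)[OF l], of "N - {{a, ?s}}" b] N(3) by simp
  then have "degree (insert {a, b} (N - {{a, ?s}})) b = 1"
    using degree_insert[OF _ n, of b] legitD(2)[OF l] by simp
  with g nr bA reachI_good show False by blast
qed

text \<open>If \<open>a\<close> were in \<open>over\<close> but not in \<open>under\<close>, the
  graph without \<open>a\<close> would have the same minimum \<open>\<nu>\<close>, and in it no
  token of degree 1 could stand on a neighbour of \<open>a\<close>: adding the edge to
  \<open>a\<close> would put \<open>a\<close> in \<open>under\<close>. An exchange with an edge set
  witnessing \<open>a \<in> over\<close> drives a token to just such a neighbour
  \<open>c\<close>.\<close>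

lemma over_subset_under: "over \<subseteq> under"
proof (rule ccontr)
  assume "\<not> over \<subseteq> under"
  then obtain a where ao: "a \<in> over" and au: "a \<notin> under" by blast
  have a: "a \<in> A" using ao by (simp add: over_def)
  obtain M' c where M': "opt M'" "c \<in> odd_verts M'" "{a, c} \<in> E" "{a, c} \<notin> M'"
    using over_witness[OF ao] by blast
  have lM': "legit M'" using M' optD by blast
  have cA: "c \<notin> A" using odd_vert_legit(1)[OF lM' M'(2)] .
  have even_nu: "even \<nu>" using even_odd[OF legitD(1)[OF lM']] optD(2)[OF M'(1)] by simp
  \<comment> \<open>These are the legit edge sets of the graph without \<open>a\<close>, phrased
    inside the full graph so that both can be compared.\<close>
  define absent where "absent N \<longleftrightarrow> N \<subseteq> E \<and> degree N a = 0 \<and> (\<forall>a'\<in>A. a' \<noteq> a \<longrightarrow> degree N a' = 2) \<and>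
      (\<forall>b. b \<notin> A \<longrightarrow> degree N b \<le> 2)" for N
  have absent_bound: "\<nu> \<le> card (odd_verts N)" if N: "absent N" for N
  proof (rule ccontr)
    assume less: "\<not> \<nu> \<le> card (odd_verts N)"
    have NE: "N \<subseteq> E" and fin: "finite N" and da: "degree N a = 0"
      using N finite_sub by (auto simp: absent_def)
    have finO: "finite (odd_verts N)" using finite_odd[OF NE] .
    let ?s = "p a True" and ?s' = "p a False"
    have sn: "{a, ?s} \<notin> N" "{a, ?s'} \<notin> N" using da degree_0_iff[OF fin] by blast+
    have ne: "?s \<noteq> a" "?s' \<noteq> a" "?s \<noteq> ?s'" using pend_neq[OF a] pend_notin[OF a] a by metis+
    define N1 where "N1 = insert {a, ?s} N"
    define N2 where "N2 = insert {a, ?s'} N1"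
    have d1: "degree N1 v = degree N v + of_bool (v = a \<or> v = ?s)" for v
      unfolding N1_def using degree_insert[OF fin sn(1), of v] by simp
    have "{a, ?s'} \<notin> N1" using sn ne by (auto simp: N1_def doubleton_eq_iff)
    then have d2: "degree N2 v = degree N1 v + of_bool (v = a \<or> v = ?s')" for v
      unfolding N2_def using degree_insert[of N1 "{a, ?s'}" v] fin by (simp add: N1_def)
    have E12: "N1 \<subseteq> E" "N2 \<subseteq> E" using NE pend_edge[OF a] by (auto simp: N1_def N2_def)
    have ds: "degree N ?s = 0" "degree N ?s' = 0" using pend_degree[OF a NE] sn by simp_all
    have so: "?s \<notin> odd_verts N" "?s' \<notin> odd_verts N" "a \<notin> odd_verts N"
      using ds da by (simp_all add: mem_odd_verts)
    have o1: "odd_verts N1 - {a} = insert ?s (odd_verts N)"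
      using so ne ds da by (auto simp: mem_odd_verts d1)
    have o2: "odd_verts N2 = insert ?s' (insert ?s (odd_verts N))"
      using so ne ds da by (auto simp: mem_odd_verts d1 d2)
    have "legit N2" unfolding legit_def
    proof (intro conjI ballI allI impI E12)
      fix x assume "x \<in> A"
      then show "degree N2 x = 2" using N da pend_notin[OF a] ne by (cases "x = a") (auto simp: d1 d2 absent_def)
    next
      fix x assume "x \<notin> A"
      moreover have "degree N x \<le> 2" using N \<open>x \<notin> A\<close> by (auto simp: absent_def)
      ultimately show "degree N2 x \<le> 2" using a ne ds by (cases "x = ?s"; cases "x = ?s'") (auto simp: d1 d2)
    qed
    then have "\<nu> \<le> card (odd_verts N) + 2" using nu_le[of N2] so ne finO by (simp add: o2)
    \<comment> \<open>Both pendant edges of \<open>a\<close> raise the count by 2, so by parity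
      \<open>N\<close> is short by exactly 2. With one pendant edge only, \<open>a\<close> carries a
      token of degree 1.\<close>
    with less even_nu even_odd[OF NE] have c: "card (odd_verts N) + 2 = \<nu>" by presburger
    have "good N1 a" unfolding good_def o1
    proof (intro conjI ballI allI impI E12)
      fix x assume "x \<in> A" "x \<noteq> a"
      then show "degree N1 x = 2" using N pend_notin[OF a, of True] by (auto simp: d1 absent_def)
    next
      fix x assume "x \<notin> A" "x \<noteq> a"
      moreover have "degree N x \<le> 2" using N \<open>x \<notin> A\<close> by (auto simp: absent_def)
      ultimately show "degree N1 x \<le> 2" using ds by (cases "x = ?s") (auto simp: d1)
    next
      show "degree N1 a \<in> {1, 3}" using da by (simp add: d1)
      show "Suc (card (insert ?s (odd_verts N))) = \<nu>" using c so finO by simp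
    qed
    moreover have "degree N1 a = 1" using da by (simp add: d1)
    ultimately show False using au a by (auto simp: under_def)
  qed
  define A' where "A' = A - {a}"
  define E' where "E' = {e \<in> E. a \<notin> e}"
  interpret G': two_factor_graph A' E'
  proof
    show "finite A'" "finite E'" using finite_A finite_E by (auto simp: A'_def E'_def)
    show "\<exists>x\<in>A'. \<exists>b. b \<notin> A' \<and> e = {x, b}" if "e \<in> E'" for e
      using edge_cases[of e] that by (auto simp: A'_def E'_def)
  qed
  have memA': "x \<in> A' \<longleftrightarrow> x \<in> A \<and> x \<noteq> a" for x by (auto simp: A'_def)
  have memE': "e \<in> E' \<longleftrightarrow> e \<in> E \<and> a \<notin> e" for e by (auto simp: E'_def)
  have degE': "degree N a = 0" if "N \<subseteq> E'" for N
    using that degree_0_iff[OF finite_sub, of N a] by (auto simp: subset_iff memE')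
  have absent_iff: "G'.legit N \<longleftrightarrow> absent N" for N
  proof
    assume N: "G'.legit N"
    then have NE: "N \<subseteq> E'" by (simp add: G'.legit_def)
    have "degree N b \<le> 2" if "b \<notin> A" for b using N that by (auto simp: G'.legit_def memA')
    moreover have "N \<subseteq> E" using NE by (auto simp: subset_iff memE')
    ultimately show "absent N" using N degE'[OF NE] by (auto simp: G'.legit_def absent_def memA')
  next
    assume N: "absent N"
    then have "N \<subseteq> E" "degree N a = 0" by (auto simp: absent_def)
    then have "N \<subseteq> E'" using degree_0_iff[OF finite_sub[OF \<open>N \<subseteq> E\<close>], of a] by (auto simp: subset_iff memE')
    moreover have "degree N b \<le> 2" if "b \<notin> A'" for b
      using N that by (cases "b = a") (auto simp: absent_def memA')
    ultimately show "G'.legit N" using N by (auto simp: G'.legit_def absent_def memA')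
  qed
  interpret G': odd_bound A' E' \<nu>
    by unfold_locales (use absent_bound absent_iff nu_pos in auto)
  have E'E: "E' \<subseteq> E" by (auto simp: subset_iff memE')
  have no_attach: False if g: "G'.good N t" and d: "degree N t = 1" and t: "{a, t} \<in> E" for N t
  proof -
    have tA: "t \<notin> A" "t \<noteq> a" using t a edge_sides edge_neq by blast+
    have NE: "N \<subseteq> E'" and fin: "finite N" using G'.goodD(1,2)[OF g] by auto
    have da: "degree N a = 0" using degE'[OF NE] .
    then have "{a, t} \<notin> N" using degree_0_iff[OF fin] by blast
    then have dg: "degree (insert {a, t} N) v = degree N v + of_bool (v = a \<or> v = t)" for v
      using degree_insert[OF fin, of "{a, t}" v] by simp
    have "odd_verts (insert {a, t} N) - {a} = odd_verts N - {t}"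
      using da d tA by (auto simp: mem_odd_verts dg)
    moreover have "insert {a, t} N \<subseteq> E" using NE E'E t by blast
    moreover have "degree (insert {a, t} N) x = 2" if "x \<in> A" "x \<noteq> a" for x
    proof -
      have "x \<in> A'" "x \<noteq> t" using that tA by (auto simp: memA')
      then show ?thesis using G'.goodD(3)[OF g] that by (simp add: dg)
    qed
    moreover have "degree (insert {a, t} N) x \<le> 2" if "x \<notin> A" "x \<noteq> a" for x
    proof -
      have "x \<notin> A'" using that by (auto simp: memA')
      then show ?thesis using G'.goodD(4)[OF g] that d by (cases "x = t") (simp_all add: dg)
    qed
    ultimately have "good (insert {a, t} N) a" unfolding good_def
      using G'.goodD(6)[OF g] da by (simp add: dg)
    moreover have "degree (insert {a, t} N) a = 1" using da by (simp add: dg)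
    ultimately show False using au a by (auto simp: under_def)
  qed
  obtain Mm where Mm: "absent Mm" "card (odd_verts Mm) \<le> \<nu>"
    using avoid_required[OF a] unfolding absent_def by blast
  then have oMm: "G'.opt Mm" unfolding G'.opt_def using absent_iff absent_bound le_antisym by blast
  have MmE: "Mm \<subseteq> E" using Mm(1) by (simp add: absent_def)
  have dMm: "degree Mm v \<le> 2" for v using G'.legitD(5) Mm(1) absent_iff by blast
  have cMm: "c \<notin> odd_verts Mm"
  proof
    assume c: "c \<in> odd_verts Mm"
    have "degree Mm c = 1" using G'.odd_vert_legit(2) Mm(1) absent_iff c by blast
    then show False using no_attach[OF G'.opt_good[OF oMm c]] M'(3) by blast
  qed
  have fin: "finite Mm" "finite M'" using finite_sub MmE legitD(2)[OF lM'] by auto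
  have c2: "card e = 2" if "e \<in> Mm \<union> M'" for e using that MmE legitD(1)[OF lM'] card_edge by blast
  have oc: "odd (degree Mm c) \<noteq> odd (degree M' c)" using cMm M'(2) by (simp add: mem_odd_verts)
  obtain N N' t where t: "t \<noteq> c" "odd (degree Mm t) \<noteq> odd (degree M' t)"
    and sub: "N \<subseteq> Mm \<union> M'" "N' \<subseteq> Mm \<union> M'"
    and d: "\<And>v. degree N v \<in> {degree Mm v, degree M' v}"
    "\<And>v. degree N' v \<in> {degree Mm v, degree M' v}"
    and o: "\<And>v. odd (degree N v) \<longleftrightarrow> odd (degree Mm v) \<noteq> (v = c \<or> v = t)"
    "\<And>v. odd (degree N' v) \<longleftrightarrow> odd (degree M' v) \<noteq> (v = c \<or> v = t)"
    by (rule symmetric_exchange[OF fin c2 dMm legitD(5)[OF lM'] oc])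
      (assumption | rule that)+
  have NE: "N \<subseteq> E" "N' \<subseteq> E" using sub MmE legitD(1)[OF lM'] by auto
  have dreq: "degree K x = 2" if "\<And>v. degree K v \<in> {degree Mm v, degree M' v}" "x \<in> A" "x \<noteq> a" for K x
    using that(1)[of x] that(2,3) Mm(1) legitD(3)[OF lM'] by (auto simp: absent_def)
  have dle: "degree K x \<le> 2" if "\<And>v. degree K v \<in> {degree Mm v, degree M' v}" for K x
    using that[of x] dMm[of x] legitD(5)[OF lM', of x] by auto
  \<comment> \<open>Otherwise \<open>N'\<close> would lose the odd vertices \<open>c\<close> and
    \<open>t\<close> of \<open>M'\<close>. Its degree at \<open>a\<close> is 0 or 2, so it is
    admissible without \<open>a\<close> or in the full graph, and neither has a minimum below
    \<open>\<nu>\<close>.\<close>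
  have tM: "t \<in> odd_verts Mm"
  proof (rule ccontr)
    assume "t \<notin> odd_verts Mm"
    with t(2) have tM': "t \<in> odd_verts M'" by (auto simp: mem_odd_verts)
    have "odd_verts N' \<subset> odd_verts M'"
    proof
      show "odd_verts N' \<subseteq> odd_verts M'"
      proof
        fix v assume "v \<in> odd_verts N'"
        then show "v \<in> odd_verts M'" using o(2)[of v] tM' M'(2) unfolding mem_odd_verts by blast
      qed
      have "t \<notin> odd_verts N'" using o(2)[of t] tM' unfolding mem_odd_verts by blast
      then show "odd_verts N' \<noteq> odd_verts M'" using tM' by blast
    qed
    then have less: "card (odd_verts N') < \<nu>"
      using psubset_card_mono[OF finite_odd[OF legitD(1)[OF lM']]] optD(2)[OF M'(1)] by metis
    have "degree N' a = 0 \<or> degree N' a = 2"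
      using d(2)[of a] Mm(1) legitD(3)[OF lM' a] by (auto simp: absent_def)
    then show False
    proof
      assume "degree N' a = 0"
      then have "absent N'" unfolding absent_def using NE dreq[OF d(2)] dle[OF d(2)] by blast
      then show False using absent_bound less by fastforce
    next
      assume "degree N' a = 2"
      then have "legit N'" unfolding legit_def using NE dreq[OF d(2)] dle[OF d(2)] by metis
      then show False using nu_le less by fastforce
    qed
  qed
  \<comment> \<open>The target \<open>N\<close> may contain edges at \<open>a\<close>, but the walk
    never inserts one: it would have to step to \<open>a\<close> from a token of degree 1, against
    \<open>no_attach\<close>. So all states belong to the graph without \<open>a\<close>.\<close>
  have "\<exists>K. (G'.good K c) \<and> degree K c = degree N c"
  proof (rule directed_walk[where M = Mm and x = t and Q = "\<lambda>K u. G'.good K u", OF fin(1) finite_sub[OF NE(1)]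
        _ dMm dle[OF d(1)] t(1)])
    show "card e = 2" if "e \<in> Mm \<union> N" for e using that MmE NE(1) card_edge by blast
    show "odd (degree Mm v) \<noteq> odd (degree N v) \<longleftrightarrow> v = t \<or> v = c" for v using o(1)[of v] by blast
    show "G'.good Mm t" using G'.opt_good[OF oMm tM] .
  next
    fix K u w
    assume *: "G'.good K u" "finite K" "u \<noteq> w" "{u, w} \<in> N - K" "degree K u < degree N u"
    have d1: "degree K u = 1" using *(1,5) dle[OF d(1), of u] G'.goodD(5)[OF *(1)] by auto
    then have ua: "u \<noteq> a" using degE'[OF G'.goodD(1)[OF *(1)]] by auto
    have uw: "{u, w} \<in> E" using * NE(1) by blast
    have "w \<noteq> a" using no_attach[OF *(1) d1] uw by (auto simp: insert_commute)
    then have "{u, w} \<in> E'" using uw ua by (auto simp: subset_iff memE')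
    then show "G'.good (insert {u, w} K) w" using G'.good_insert(1)[OF *(1)] * d1 by blast
  next
    fix K u w
    assume *: "G'.good K u" "finite K" "u \<noteq> w" "{u, w} \<in> K - N" "degree K u > degree N u"
    have "degree K u = 3 \<or> u \<notin> A'"
      using *(1,5) dreq[OF d(1), of u] G'.goodD(5)[OF *(1)] by (auto simp: memA')
    then show "G'.good (K - {{u, w}}) w" using G'.good_remove(1)[OF *(1)] * by blast
  qed
  then obtain K where K: "G'.good K c" "degree K c = degree N c" by blast
  have "odd (degree N c)" using o(1)[of c] cMm unfolding mem_odd_verts by blast
  then have "degree K c = 1" using K(2) G'.goodD(5)[OF K(1)] dle[OF d(1), of c] by auto
  then show False using no_attach[OF K(1)] M'(3) by blast
qed

lemma reach_neighbour_under:
  assumes "b \<in> reach" "{a, b} \<in> E"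
  shows "a \<in> under"
proof -
  obtain M where M: "opt M" "b \<in> odd_verts M" using assms(1) by (auto simp: reach_def)
  show ?thesis using opt_remove(3)[OF M] overI[OF M assms(2)] over_subset_under by blast
qed

lemma over_pendants_par:
  assumes "a \<in> over"
  shows "par (p a True) (p a False)"
proof (rule ccontr)
  assume np: "\<not> ?thesis"
  have a: "a \<in> A" using assms by (simp add: over_def)
  obtain M c where M: "opt M" "c \<in> odd_verts M" "{a, c} \<in> E" "{a, c} \<notin> M"
    using over_witness[OF assms] by blast
  have "c \<in> reach" using M reachI by blast
  then have "\<not> par c (p a True) \<or> \<not> par c (p a False)" using par_trans par_sym np by blast
  then obtain i where "\<not> par c (p a i)" by blast
  then obtain M4 where M4: "opt M4" "c \<in> odd_verts M4" "p a i \<in> odd_verts M4" "p a i \<noteq> c"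
    by (auto simp: par_def)
  let ?s = "p a i"
  have edge: "{a, ?s} \<in> K" if "opt K" "?s \<in> odd_verts K" for K
    using that pend_odd[OF a] legitD(1) optD(1) by blast
  have s: "?s \<notin> odd_verts M" using opt_swap[OF M(1) _ M(2) M4(4) edge[OF M(1)] M(3)] M(4) by blast
  have s4: "?s \<in> odd_verts M4 - odd_verts M" using M4(3) s by blast
  obtain N x where N: "x \<in> odd_verts M - odd_verts M4" "opt N"
    "odd_verts N = insert ?s (odd_verts M - {x})"
    using opt_exchange[OF M(1) M4(1) s4] by blast
  \<comment> \<open>The start \<open>x\<close> is even in \<open>M4\<close> and thus differs from
    \<open>c\<close>; later the token cannot enter \<open>c\<close>, because \<open>c\<close> stays
    odd.\<close>
  show False
  proof (rule good_walk[OF M(1) N(2) _ s N(3),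
        where Q = "\<lambda>K t. c \<in> odd_verts K \<and> {a, c} \<notin> K \<and> t \<noteq> c"])
    show "x \<in> odd_verts M" using N(1) by blast
    show "c \<in> odd_verts M \<and> {a, c} \<notin> M \<and> x \<noteq> c" using M M4 N(1) by blast
  next
    fix K K' t w
    assume *: "good K t" "c \<in> odd_verts K \<and> {a, c} \<notin> K \<and> t \<noteq> c" "good K' w" "w \<notin> odd_verts K"
      "K' = insert {t, w} K \<and> {t, w} \<notin> K \<and> degree K t < 2 \<or> K' = K - {{t, w}} \<and> {t, w} \<in> K"
    have w: "w \<noteq> c" using * by blast
    have "degree K' c = degree K c"
      using degree_flip_other[OF goodD(2)[OF *(1)], of c t w K'] * w by auto
    moreover have "{a, c} \<noteq> {t, w}" using * w by auto
    ultimately show "c \<in> odd_verts K' \<and> {a, c} \<notin> K' \<and> w \<noteq> c"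
      using * w by (auto simp: mem_odd_verts)
  next
    fix K assume K: "opt K" "?s \<in> odd_verts K" "c \<in> odd_verts K \<and> {a, c} \<notin> K \<and> ?s \<noteq> c"
    then show False using opt_swap[OF K(1,2) _ M4(4) edge[OF K(1,2)] M(3)] by blast
  qed
qed

text \<open>Otherwise a pendant of \<open>a\<close> would fail to be parallel to some neighbour
  \<open>\<beta>\<close> of \<open>a\<close>. With both odd, \<open>a\<close> uses the edges to
  both, and trading the edge to \<open>\<beta>\<close> for the second pendant edge makes both
  pendants odd.\<close>

lemma over_neighbours_par:
  assumes "a \<in> over" "{a, b} \<in> E" "{a, c} \<in> E"
  shows "par b c"
proof (rule ccontr)
  assume np: "\<not> par b c"
  have a: "a \<in> A" using assms by (simp add: over_def)
  have au: "a \<in> under" using assms(1) over_subset_under by blast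
  let ?s = "p a True" and ?s' = "p a False"
  have "?s \<in> reach" using under_pendant_reach[OF au] .
  then have "\<not> par ?s b \<or> \<not> par ?s c" using np par_trans par_sym by blast
  then obtain \<beta> where \<beta>: "\<not> par ?s \<beta>" "{a, \<beta>} \<in> E" using assms(2,3) by blast
  then obtain M where M: "opt M" "?s \<in> odd_verts M" "\<beta> \<in> odd_verts M" "?s \<noteq> \<beta>" by (auto simp: par_def)
  have l: "legit M" using M optD by blast
  have s: "{a, ?s} \<in> M" using pend_odd[OF a legitD(1)[OF l]] M(2) by blast
  have b: "{a, \<beta>} \<in> M" using opt_swap[OF M s \<beta>(2)] .
  have contra: False if "opt K" "{a, ?s} \<in> K" "{a, ?s'} \<in> K" for K
    using over_pendants_par[OF assms(1)] pend_odd[OF a legitD(1)[OF optD(1)[OF that(1)]]] that pend_neq[OF a]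
    unfolding par_def by blast
  note r = opt_remove[OF M(1,3) b]
  have n: "{a, ?s'} \<notin> M" using contra[OF M(1) s] by blast
  have g: "good (insert {a, ?s'} (M - {{a, \<beta>}})) ?s'"
    using good_insert(1)[OF r(1) pend_edge[OF a] _ r(2)] n by blast
  have "degree (insert {a, ?s'} (M - {{a, \<beta>}})) ?s' = 1"
    using pend_degree[OF a goodD(1)[OF g], of False] by simp
  then have "opt (insert {a, ?s'} (M - {{a, \<beta>}}))" using good_opt[OF g pend_notin[OF a]] by blast
  moreover have "{a, ?s} \<noteq> {a, \<beta>}" using M(4) by (auto simp: doubleton_eq_iff)
  ultimately show False using contra[of "insert {a, ?s'} (M - {{a, \<beta>}})"] s by blast
qed

end

section \<open>Deficient vertices and the number of odd vertices\<close>

context critical_graph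
begin

text \<open>Linked classes are what remains connected in \<open>reach\<close> when only
  \<open>over\<close> is used to pass. Each lies in one parallel class, so an optimal edge set has
  at most one odd vertex in it.\<close>

definition link :: "('v \<times> 'v) set" where
  "link = {(b, c). b \<in> reach \<and> c \<in> reach \<and> (\<exists>a\<in>over. {a, b} \<in> E \<and> {a, c} \<in> E)}"

lemma link_star:
  assumes "(b, c) \<in> link\<^sup>*" "b \<in> reach"
  shows "c \<in> reach \<and> par b c"
  using assms(1)
proof (induction rule: rtrancl_induct)
  case base
  then show ?case using assms(2) by (simp add: par_def)
next
  case (step c d)
  then have "par c d" "d \<in> reach" using over_neighbours_par by (auto simp: link_def)
  then show ?case using step.IH par_trans by blast
qed

text \<open>If no edge of \<open>M\<close> led from the class of \<open>b\<close> to \<open>under - over\<close>, then \<open>b\<close> would be the only odd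
  vertex of the graph formed by the edges of \<open>M\<close> at that class.\<close>

lemma class_edge:
  assumes M: "opt M" "b \<in> odd_verts M"
  shows "\<exists>d c. d \<in> under - over \<and> {d, c} \<in> M \<and> (b, c) \<in> link\<^sup>*"
proof (rule ccontr)
  assume none: "\<not> ?thesis"
  have l: "legit M" using M optD by blast
  have fin: "finite M" using legitD(2)[OF l] .
  have bR: "b \<in> reach" using reachI[OF M] .
  define K where "K = {c. (b, c) \<in> link\<^sup>*}"
  define MK where "MK = {e \<in> M. e \<inter> K \<noteq> {}}"
  have KR: "c \<in> reach" "par b c" if "c \<in> K" for c using link_star[OF _ bR] that by (auto simp: K_def)
  have KA: "c \<notin> A" if "c \<in> K" for c using KR(1)[OF that] reach_notin by blast
  have "odd_verts MK = {b}"
  proof (rule set_eqI)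
    fix v
    consider "v \<in> K" | "v \<notin> K" "v \<notin> A" | "v \<in> A" using KA by blast
    then show "v \<in> odd_verts MK \<longleftrightarrow> v \<in> {b}"
    proof cases
      case 1
      then have "{e \<in> MK. v \<in> e} = {e \<in> M. v \<in> e}" by (auto simp: MK_def)
      then have "v \<in> odd_verts MK \<longleftrightarrow> v \<in> odd_verts M" by (simp add: mem_odd_verts degree_def)
      then show ?thesis using KR(2)[OF 1] M by (auto simp: par_def)
    next
      case 2
      have "degree MK v = 0"
      proof (rule degree_eq_0, rule notI)
        fix e assume "e \<in> MK" "v \<in> e"
        then obtain c where e: "e \<in> M" "v \<in> e" "c \<in> e" "c \<in> K" by (auto simp: MK_def)
        then have eE: "e \<in> E" using legitD(1)[OF l] by blast
        obtain w where "e = {v, w}" using other_end[OF eE e(2)] by blast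
        then show False using e 2 KA[OF e(4)] edge_sides[of v w] eE by auto
      qed
      moreover have "v \<noteq> b" using 2 by (auto simp: K_def)
      ultimately show ?thesis by (simp add: mem_odd_verts)
    next
      case 3
      then have vb: "v \<noteq> b" using bR reach_notin by blast
      have "even (degree MK v)"
      proof (cases "\<exists>e\<in>MK. v \<in> e")
        case False
        then have "degree MK v = 0" by (intro degree_eq_0) blast
        then show ?thesis by simp
      next
        case True
        then obtain e c where e: "e \<in> M" "v \<in> e" "c \<in> e" "c \<in> K" by (auto simp: MK_def)
        then have eE: "e \<in> E" using legitD(1)[OF l] by blast
        have "c \<noteq> v" using KA[OF e(4)] 3 by blast
        then have ec: "e = {v, c}" using other_end[OF eE e(2)] e(3) by auto
        have vU: "v \<in> under" using reach_neighbour_under[OF KR(1)[OF e(4)]] eE ec by blast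
        have vO: "v \<in> over" using none vU e ec by (auto simp: K_def)
        \<comment> \<open>All neighbours of a vertex of \<open>over\<close> lie in one linked class,
          so all edges of \<open>M\<close> at \<open>v\<close> belong to \<open>MK\<close> and its
          degree there is 2.\<close>
        have "f \<in> MK" if f: "f \<in> M" "v \<in> f" for f
        proof -
          have fE: "f \<in> E" using f legitD(1)[OF l] by blast
          obtain w where w: "f = {v, w}" using other_end[OF fE f(2)] by blast
          have "w \<in> reach" using under_neighbour_reach[OF vU] w fE by blast
          then have "(c, w) \<in> link" using KR(1)[OF e(4)] vO w fE ec eE by (auto simp: link_def)
          then have "w \<in> K" using e(4) by (auto simp: K_def)
          then show ?thesis using w f by (auto simp: MK_def)
        qed
        then have "{e \<in> MK. v \<in> e} = {e \<in> M. v \<in> e}" by (auto simp: MK_def)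
        then have "degree MK v = degree M v" by (simp add: degree_def)
        then show ?thesis using legitD(3)[OF l 3] by simp
      qed
      then show ?thesis using vb by (simp add: mem_odd_verts)
    qed
  qed
  moreover have "MK \<subseteq> E" using legitD(1)[OF l] by (auto simp: MK_def)
  ultimately show False using even_odd[of MK] by simp
qed

text \<open>Two odd vertices of \<open>M\<close> are not parallel, so \<open>class_edge\<close>
  assigns them different edges, and each vertex of \<open>under - over\<close> offers only two edges
  of \<open>M\<close>.\<close>

lemma nu_le_deficient: "\<nu> \<le> 2 * card (under - over)"
proof -
  let ?D = "under - over"
  have DA: "?D \<subseteq> A" by (auto simp: under_def)
  then have finD: "finite ?D" using finite_A finite_subset by blast
  obtain M where M: "opt M" using ex_opt by blast
  have l: "legit M" using M optD by blast
  have fin: "finite M" using legitD(2)[OF l] .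
  have "\<forall>b\<in>odd_verts M. \<exists>d c. d \<in> ?D \<and> {d, c} \<in> M \<and> (b, c) \<in> link\<^sup>*"
    using class_edge[OF M] by (intro ballI)
  then obtain d c where dc: "\<And>b. b \<in> odd_verts M \<Longrightarrow> d b \<in> ?D \<and> {d b, c b} \<in> M \<and> (b, c b) \<in> link\<^sup>*"
    by metis
  define f where "f b = {d b, c b}" for b
  have "inj_on f (odd_verts M)"
  proof (rule inj_onI)
    fix b b' assume b: "b \<in> odd_verts M" "b' \<in> odd_verts M" and eq: "f b = f b'"
    have R: "b \<in> reach" "b' \<in> reach" using reachI[OF M] b by auto
    have s: "c b \<in> reach" "par b (c b)" "c b' \<in> reach" "par b' (c b')"
      using link_star dc b R by blast+
    have "c b \<notin> A" "c b' \<notin> A" "d b \<in> A" "d b' \<in> A" using s reach_notin dc[OF b(1)] dc[OF b(2)] DA by blast+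
    then have "c b = c b'" using eq by (auto simp: f_def doubleton_eq_iff)
    then have "par b b'" using s par_trans[of "c b" b b'] par_sym by simp
    then show "b = b'" using M b by (auto simp: par_def)
  qed
  then have "card (odd_verts M) = card (f ` odd_verts M)" by (simp add: card_image)
  also have "\<dots> \<le> card (\<Union>d\<in>?D. {e \<in> M. d \<in> e})"
  proof (rule card_mono)
    show "finite (\<Union>d\<in>?D. {e \<in> M. d \<in> e})" using finD fin by auto
    show "f ` odd_verts M \<subseteq> (\<Union>d\<in>?D. {e \<in> M. d \<in> e})" using dc by (auto simp: f_def)
  qed
  also have "\<dots> \<le> (\<Sum>d\<in>?D. card {e \<in> M. d \<in> e})" using finD by (rule card_UN_le)
  also have "\<dots> = (\<Sum>d\<in>?D. 2)" using legitD(3)[OF l] DA by (intro sum.cong) (auto simp: degree_def)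
  finally show ?thesis using optD(2)[OF M] by simp
qed

lemma opt_deficient_edge:
  assumes "opt M" "b \<in> odd_verts M" "a \<in> under - over" "{a, b} \<in> E"
  shows "{a, b} \<in> M"
  using assms overI by blast

text \<open>Make \<open>b\<close> odd. Each neighbour of \<open>b\<close> in
  \<open>under - over\<close> must use its edge to \<open>b\<close>, or it would be in
  \<open>over\<close>; but \<open>b\<close> has degree 1.\<close>

lemma deficient_unique:
  assumes "a \<in> under - over" "a' \<in> under - over" "{a, b} \<in> E" "{a', b} \<in> E"
  shows "a = a'"
proof (rule ccontr)
  assume n: "a \<noteq> a'"
  have "b \<in> reach" using under_neighbour_reach assms by blast
  then obtain M where M: "opt M" "b \<in> odd_verts M" by (auto simp: reach_def)
  have l: "legit M" using M optD by blast
  have "{{a, b}, {a', b}} \<subseteq> {e \<in> M. b \<in> e}" using opt_deficient_edge[OF M] assms by blast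
  then have "card {{a, b}, {a', b}} \<le> degree M b"
    unfolding degree_def using legitD(2)[OF l] by (intro card_mono) auto
  moreover have "{a, b} \<noteq> {a', b}" using n by (auto simp: doubleton_eq_iff)
  ultimately show False using odd_vert_legit(2)[OF l M(2)] by simp
qed

text \<open>Every vertex of \<open>A\<close> except \<open>a\<close> is in \<open>over\<close>, and
  any two of them share a neighbour, so all their neighbours are parallel. Rerouting one edge of
  \<open>a\<close> to a second common neighbour with \<open>a'\<close> makes two such neighbours odd
  at once.\<close>

lemma deficient_not_singleton:
  assumes D: "under - over = {a}"
    and common: "\<And>x y. x \<in> A \<Longrightarrow> y \<in> A \<Longrightarrow> x \<noteq> y \<Longrightarrow>
      \<exists>b c. b \<noteq> c \<and> {x, b} \<in> E \<and> {y, b} \<in> E \<and> {x, c} \<in> E \<and> {y, c} \<in> E"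
    and other: "a' \<in> A" "a' \<noteq> a"
  shows False
proof -
  have aU: "a \<in> under" and aA: "a \<in> A" using D by (auto simp: under_def)
  have aD: "a \<in> under - over" using D by simp
  have O: "x \<in> over" if x: "x \<in> A" "x \<noteq> a" for x
  proof -
    obtain b where "{a, b} \<in> E" "{x, b} \<in> E" using common[OF aA x(1)] x(2) by metis
    then have "x \<in> under" using under_neighbour_reach[OF aU] reach_neighbour_under by blast
    then show ?thesis using D x(2) by blast
  qed
  have P: "par b c" if e: "{x, b} \<in> E" "{y, c} \<in> E" "x \<in> A" "y \<in> A" "x \<noteq> a" "y \<noteq> a" for b c x y
  proof (cases "x = y")
    case True
    then show ?thesis using over_neighbours_par[OF O] e by blast
  next
    case False
    then obtain d where d: "{x, d} \<in> E" "{y, d} \<in> E" using common e by metis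
    have "d \<in> reach" using under_neighbour_reach d(1) O[OF e(3,5)] over_subset_under by blast
    moreover have "par b d" "par d c" using over_neighbours_par[OF O] e d by blast+
    ultimately show ?thesis using par_trans by blast
  qed
  obtain b c where bc: "b \<noteq> c" "{a, b} \<in> E" "{a', b} \<in> E" "{a, c} \<in> E" "{a', c} \<in> E"
    using common[OF aA other(1)] other(2) by metis
  have "b \<in> reach" using under_neighbour_reach[OF aU bc(2)] .
  then obtain M where M: "opt M" "b \<in> odd_verts M" by (auto simp: reach_def)
  have l: "legit M" using M optD by blast
  have bA: "b \<notin> A" and cA: "c \<notin> A" using edge_sides bc aA by blast+
  have ab: "{a, b} \<in> M" using opt_deficient_edge[OF M aD bc(2)] .
  have fO: "finite (odd_verts M)" using finite_odd legitD(1)[OF l] .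
  \<comment> \<open>Parity supplies a second odd vertex \<open>x\<close>. Its edge must lead to
    \<open>a\<close>, since otherwise \<open>x\<close> would be parallel to
    \<open>b\<close>.\<close>
  have "card (odd_verts M) \<noteq> 1" using even_odd[OF legitD(1)[OF l]] by auto
  then have "odd_verts M \<noteq> {b}" by auto
  then obtain x where x: "x \<in> odd_verts M" "x \<noteq> b" using M(2) by blast
  have xA: "x \<notin> A" and dx: "degree M x = 1" using odd_vert_legit[OF l x(1)] by auto
  then have "\<exists>e\<in>M. x \<in> e" using degree_0_iff[OF legitD(2)[OF l], of x] by simp
  then obtain e where e: "e \<in> M" "x \<in> e" by blast
  then have eE: "e \<in> E" using legitD(1)[OF l] by blast
  obtain y where y: "e = {x, y}" using other_end[OF eE e(2)] by blast
  have yA: "y \<in> A" using edge_sides y eE xA by blast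
  have "y = a"
  proof (rule ccontr)
    assume "y \<noteq> a"
    then have "par b x" using P[OF bc(3) _ other(1) yA other(2)] y eE by (simp add: insert_commute)
    then show False using M x by (auto simp: par_def)
  qed
  then have ax: "{a, x} \<in> M" using e y by (simp add: insert_commute)
  define N where "N = M - {{a, x}}"
  have gN: "good N a" "degree N a = 1" using opt_remove[OF M(1) x(1) ax] by (auto simp: N_def)
  have dN: "degree M v = degree N v + of_bool (v = a \<or> v = x)" for v
    unfolding N_def using degree_remove[OF legitD(2)[OF l] ax, of v] by simp
  have abN: "{a, b} \<in> N" using ab x(2) by (auto simp: N_def doubleton_eq_iff)
  have acN: "{a, c} \<notin> N"
  proof
    assume "{a, c} \<in> N"
    then have "card {{a, b}, {a, c}} \<le> degree N a"
      unfolding degree_def using abN goodD(2)[OF gN(1)] by (intro card_mono) auto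
    moreover have "{a, b} \<noteq> {a, c}" using bc(1) by (auto simp: doubleton_eq_iff)
    ultimately show False using gN(2) by simp
  qed
  define N1 where "N1 = insert {a, c} N"
  have g1: "good N1 c" unfolding N1_def using good_insert(1)[OF gN(1) bc(4) acN gN(2)] .
  have d1: "degree N1 v = degree N v + of_bool (v = a \<or> v = c)" for v
    unfolding N1_def using degree_insert[OF goodD(2)[OF gN(1)] acN, of v] by simp
  have ba: "b \<noteq> a" using bA aA by blast
  have b1: "degree N1 b = 1" using d1[of b] dN[of b] ba x(2) bc(1) odd_vert_legit(2)[OF l M(2)] by simp
  have pbc: "par b c" using P[OF bc(3,5) other(1) other(1) other(2) other(2)] .
  show False
  proof (cases "degree N1 c = 1")
    case True
    then show False using good_opt[OF g1 cA] b1 pbc bc(1) by (auto simp: par_def mem_odd_verts)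
  next
    case False
    \<comment> \<open>Here \<open>c\<close> had degree 2 before. The token moves on to some
      \<open>z\<close> other than \<open>a\<close> and leaves through a pendant of \<open>z\<close>,
      which is parallel to \<open>b\<close> as well.\<close>
    then have d3: "degree N1 c = 3" using goodD(5)[OF g1] by blast
    have fin1: "finite N1" using goodD(2)[OF g1] .
    have "\<not> {e \<in> N1. c \<in> e} \<subseteq> {{a, c}}"
    proof
      assume "{e \<in> N1. c \<in> e} \<subseteq> {{a, c}}"
      then have "degree N1 c \<le> card {{a, c}}" unfolding degree_def by (intro card_mono) auto
      then show False using d3 by simp
    qed
    then obtain f where f: "f \<in> N1" "c \<in> f" "f \<noteq> {a, c}" by blast
    then have fE: "f \<in> E" using goodD(1)[OF g1] by blast
    obtain z where z: "f = {c, z}" "c \<noteq> z" using other_end[OF fE f(2)] by blast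
    have zA: "z \<in> A" using edge_sides z fE cA by blast
    have za: "z \<noteq> a" using f(3) z by (auto simp: insert_commute)
    define N2 where "N2 = N1 - {{c, z}}"
    have g2: "good N2 z" unfolding N2_def using good_remove(1)[OF g1] f z d3 by blast
    have d2: "degree N1 v = degree N2 v + of_bool (v = c \<or> v = z)" for v
      unfolding N2_def using degree_remove[OF fin1, of "{c, z}" v] f z by simp
    have "degree N2 z = 1" using d2[of z] goodD(3)[OF g1 zA] z(2) by simp
    then obtain i where i: "{z, p z i} \<notin> N2" "opt (insert {z, p z i} N2)"
      "p z i \<in> odd_verts (insert {z, p z i} N2)"
      using under_add_pendant[OF zA g2] by blast
    have nb: "p z i \<noteq> b"
    proof
      assume "p z i = b"
      then have "{a, b} = {z, b}" using pend_only[OF zA bc(2), of i] by simp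
      then show False using za ba by (auto simp: doubleton_eq_iff)
    qed
    have bz: "b \<noteq> z" using bA zA by blast
    have "degree (insert {z, p z i} N2) b = degree N2 b"
      using degree_insert[OF goodD(2)[OF g2] i(1), of b] nb bz by simp
    then have "degree (insert {z, p z i} N2) b = 1" using d2[of b] b1 bz bc(1) by simp
    then have "b \<in> odd_verts (insert {z, p z i} N2)" by (simp add: mem_odd_verts)
    moreover have "par b (p z i)" using P[OF bc(3) pend_edge[OF zA] other(1) zA other(2) za] .
    ultimately show False using i(2,3) nb by (auto simp: par_def)
  qed
qed

end

section \<open>Reduction to a critical graph\<close>

definition common_nbrs :: "'v set set \<Rightarrow> 'v set \<Rightarrow> 'v set" where
  "common_nbrs E X = {b. \<exists>x\<in>X. \<exists>y\<in>X. x \<noteq> y \<and> {x, b} \<in> E \<and> {y, b} \<in> E}"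

text \<open>A maximal set \<open>Z\<close> whose deletion raises the minimal number of odd vertices by \<open>2 * card Z\<close> leaves
  a critical graph; there \<open>D = under - over\<close> violates the double Hall property, as its common
  neighbours lie in \<open>Z\<close>.\<close>

lemma (in two_factor_graph) ex_two_factor_pendants:
  fixes p :: "'v \<Rightarrow> bool \<Rightarrow> 'v"
  assumes pend_edge: "\<And>a i. a \<in> A \<Longrightarrow> {a, p a i} \<in> E"
    and pend_only: "\<And>a e i. a \<in> A \<Longrightarrow> e \<in> E \<Longrightarrow> p a i \<in> e \<Longrightarrow> e = {a, p a i}"
    and pend_neq: "\<And>a. a \<in> A \<Longrightarrow> p a True \<noteq> p a False"
    and dHp: "\<And>X. X \<subseteq> A \<Longrightarrow> 2 \<le> card X \<Longrightarrow> card X \<le> card (common_nbrs E X)"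
    and A2: "2 \<le> card A"
  shows "\<exists>M. legit M \<and> odd_verts M = {}"
proof (rule ccontr)
  assume none: "\<not> ?thesis"
  define EZ where "EZ Z = {e \<in> E. e \<inter> Z = {}}" for Z
  define lg where "lg Z M \<longleftrightarrow> two_factor_graph.legit (A - Z) (EZ Z) M" for Z M
  define nu where "nu Z = (LEAST n. \<exists>M. lg Z M \<and> card (odd_verts M) = n)" for Z
  define pend where "pend = (\<Union>a\<in>A. range (p a))"
  \<comment> \<open>Pendants are never deleted, so the remaining vertices of \<open>A\<close> keep
    both pendant edges and legit edge sets exist for every \<open>Z\<close>.\<close>
  define W where "W = (A \<union> \<Union>E) - pend"
  have tf: "two_factor_graph (A - Z) (EZ Z)" for Z
  proof
    show "finite (A - Z)" "finite (EZ Z)" using finite_A finite_E by (auto simp: EZ_def)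
    show "\<exists>a\<in>A - Z. \<exists>b. b \<notin> A - Z \<and> e = {a, b}" if "e \<in> EZ Z" for e
      using edge_cases[of e] that by (auto simp: EZ_def)
  qed
  have lg_def': "lg Z M \<longleftrightarrow> M \<subseteq> EZ Z \<and> (\<forall>a\<in>A - Z. degree M a = 2) \<and> (\<forall>b. b \<notin> A - Z \<longrightarrow> degree M b \<le> 2)" for Z M
    unfolding lg_def two_factor_graph.legit_def[OF tf] ..
  have pA: "p a i \<notin> A" if "a \<in> A" for a i using pend_edge[OF that] that edge_sides by blast
  have EZE: "EZ Z \<subseteq> E" for Z by (auto simp: EZ_def)
  have ex: "\<exists>M. lg Z M" if Z: "Z \<subseteq> W" for Z
  proof -
    define M where "M = (\<Union>a\<in>A - Z. {{a, p a True}, {a, p a False}})"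
    have pZ: "p a i \<notin> Z" if "a \<in> A" for a i using that Z by (auto simp: W_def pend_def)
    have "M \<subseteq> EZ Z"
    proof
      fix e assume "e \<in> M"
      then obtain a i where "a \<in> A - Z" "e = {a, p a i}" by (auto simp: M_def)
      then show "e \<in> EZ Z" using pend_edge[of a i] pZ[of a i] by (auto simp: EZ_def)
    qed
    moreover have "degree M a = 2" if a: "a \<in> A - Z" for a
    proof -
      have "{e \<in> M. a \<in> e} = {{a, p a True}, {a, p a False}}"
        using a pA by (auto simp: M_def)
      moreover have "{a, p a True} \<noteq> {a, p a False}" using pend_neq[of a] a by (auto simp: doubleton_eq_iff)
      ultimately show ?thesis by (simp add: degree_def)
    qed
    moreover have "degree M b \<le> 2" if b: "b \<notin> A - Z" for b
    proof (cases "\<exists>a\<in>A - Z. \<exists>i. b = p a i")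
      case True
      then obtain a i where a: "a \<in> A" "b = p a i" by blast
      have "{e \<in> M. b \<in> e} \<subseteq> {{a, p a i}}"
        using pend_only[OF a(1)] a(2) \<open>M \<subseteq> EZ Z\<close> EZE by blast
      then have "degree M b \<le> card {{a, p a i}}" unfolding degree_def by (intro card_mono) auto
      then show ?thesis by simp
    next
      case False
      then have "degree M b = 0" using b by (intro degree_eq_0) (auto simp: M_def)
      then show ?thesis by simp
    qed
    ultimately show ?thesis using lg_def' by blast
  qed
  have nu_attained: "\<exists>M. lg Z M \<and> card (odd_verts M) = nu Z" if "Z \<subseteq> W" for Z
    unfolding nu_def by (rule LeastI_ex) (use ex[OF that] in blast)
  have nu_least: "nu Z \<le> card (odd_verts M)" if "lg Z M" for Z M
    unfolding nu_def by (rule Least_le) (use that in blast)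
  have lgE: "M \<subseteq> E" if "lg Z M" for Z M using that EZE lg_def' by blast
  have nu_even: "even (nu Z)" if "Z \<subseteq> W" for Z
    using nu_attained[OF that] even_odd lgE by metis
  have "nu {} \<noteq> 0"
  proof
    assume "nu {} = 0"
    then obtain M where M: "lg {} M" "card (odd_verts M) = 0" using nu_attained[of "{}"] by auto
    then have "odd_verts M = {}" using finite_odd[OF lgE[OF M(1)]] by simp
    moreover have "legit M" using M(1) unfolding lg_def' legit_def EZ_def by simp
    ultimately show False using none by blast
  qed
  then have nu0: "2 \<le> nu {}" using nu_even[of "{}"] by (cases "nu {} = 1") auto
  have "finite e" if "e \<in> E" for e using card_edge[OF that] card.infinite by fastforce
  then have finW: "finite W" using finite_A finite_E by (simp add: W_def)
  define S where "S = {Z. Z \<subseteq> W \<and> nu {} + 2 * card Z \<le> nu Z}"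
  have "finite S" using finW by (simp add: S_def)
  moreover have "S \<noteq> {}" by (auto simp: S_def)
  ultimately obtain Z where Z: "Z \<in> S" and maxZ: "\<And>Y. Y \<in> S \<Longrightarrow> card Y \<le> card Z"
    using obtains_MAX[of S card] Max_ge[of "card ` S"] by (metis finite_imageI image_eqI)
  have ZW: "Z \<subseteq> W" and nuZ: "nu {} + 2 * card Z \<le> nu Z" using Z by (auto simp: S_def)
  have finZ: "finite Z" using ZW finW finite_subset by blast
  \<comment> \<open>By maximality of \<open>Z\<close>, deleting \<open>v\<close> as well raises the
    minimum by less than 2; as minima are even, it does not raise it at all.\<close>
  have inessential: "\<exists>M. lg (insert v Z) M \<and> card (odd_verts M) \<le> nu Z" if v: "v \<in> W - Z" for v
  proof -
    have sub: "insert v Z \<subseteq> W" using v ZW by blast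
    have "card (insert v Z) = Suc (card Z)" using v finZ by simp
    then have "insert v Z \<notin> S" using maxZ[of "insert v Z"] by auto
    then have "nu (insert v Z) < nu {} + 2 * Suc (card Z)"
      using sub v finZ by (simp add: S_def)
    then have "nu (insert v Z) < nu Z + 2" using nuZ by simp
    moreover have "even (nu (insert v Z))" "even (nu Z)" using nu_even sub ZW by auto
    ultimately have "nu (insert v Z) \<le> nu Z" by presburger
    then show ?thesis using nu_attained[OF sub] by auto
  qed
  interpret G: two_factor_graph "A - Z" "EZ Z" by (rule tf)
  have lgZ: "G.legit M \<longleftrightarrow> lg Z M" for M by (simp add: lg_def)
  interpret G: odd_bound "A - Z" "EZ Z" "nu Z"
    by unfold_locales (use nu_least lgZ nu0 nuZ in auto)
  have pW: "p a i \<notin> W" if "a \<in> A" for a i using that by (auto simp: W_def pend_def)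
  have deg0: "degree M v = 0" if "M \<subseteq> EZ Y" "v \<in> Y" for M v Y
    using that degree_0_iff[OF finite_sub, of M v] EZE[of Y] by (fastforce simp: EZ_def)
  interpret G: critical_graph "A - Z" "EZ Z" "nu Z" p
  proof
    show "{a, p a i} \<in> EZ Z" if "a \<in> A - Z" for a i
      using that pend_edge[of a i] pW[of a i] ZW by (auto simp: EZ_def)
    show "e = {a, p a i}" if "a \<in> A - Z" "e \<in> EZ Z" "p a i \<in> e" for a e i
      using that pend_only[of a e i] EZE by blast
    show "p a True \<noteq> p a False" if "a \<in> A - Z" for a using that pend_neq by blast
    show ex_opt: "\<exists>M. G.opt M" using nu_attained[OF ZW] lgZ by (auto simp: G.opt_def)
    show "\<exists>M. G.opt M \<and> degree M b = 0" if b: "b \<notin> A - Z" "\<And>a i. a \<in> A - Z \<Longrightarrow> b \<noteq> p a i" for b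
    proof (cases "b \<in> W - Z")
      case True
      then obtain M where M: "lg (insert b Z) M" "card (odd_verts M) \<le> nu Z" using inessential by blast
      have "A - insert b Z = A - Z" using b(1) by blast
      moreover have "EZ (insert b Z) \<subseteq> EZ Z" by (auto simp: EZ_def)
      ultimately have "lg Z M" using M(1) unfolding lg_def' by auto
      then have "G.opt M" unfolding G.opt_def lgZ using M(2) nu_least[of Z M] by simp
      moreover have "degree M b = 0" using deg0[of M "insert b Z" b] M(1) lg_def' by blast
      ultimately show ?thesis by blast
    next
      case False
      \<comment> \<open>Now \<open>b\<close> is deleted, isolated, or a pendant of a deleted vertex,
        so no remaining edge contains it.\<close>
      obtain M where M: "G.opt M" using ex_opt by blast
      have ME: "M \<subseteq> EZ Z" using M lgZ lg_def' by (auto simp: G.opt_def)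
      have "degree M b = 0"
      proof (cases "b \<in> Z")
        case True
        then show ?thesis using deg0[OF ME] by blast
      next
        case bZ: False
        have "b \<notin> e" if "e \<in> M" for e
        proof
          assume be: "b \<in> e"
          have eZ: "e \<in> E" "e \<inter> Z = {}" using that ME by (auto simp: EZ_def)
          then have "b \<in> pend" using False bZ be by (auto simp: W_def)
          then obtain a i where a: "a \<in> A" "b = p a i" by (auto simp: pend_def)
          then have "e = {a, p a i}" using pend_only eZ(1) be by blast
          then have "a \<notin> Z" using eZ(2) by blast
          then show False using b(2)[of a i] a by blast
        qed
        then show ?thesis using degree_0_iff[OF finite_sub, of M b] ME EZE by blast
      qed
      then show ?thesis using M by blast
    qed
    show "\<exists>M\<subseteq>EZ Z. degree M a = 0 \<and> (\<forall>a'\<in>A - Z. a' \<noteq> a \<longrightarrow> degree M a' = 2) \<and>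
      (\<forall>b. b \<notin> A - Z \<longrightarrow> degree M b \<le> 2) \<and> card (odd_verts M) \<le> nu Z" if a: "a \<in> A - Z" for a
    proof -
      have "a \<in> W - Z" using a pA by (auto simp: W_def pend_def)
      then obtain M where M: "lg (insert a Z) M" "card (odd_verts M) \<le> nu Z" using inessential by blast
      have "EZ (insert a Z) \<subseteq> EZ Z" by (auto simp: EZ_def)
      moreover have "degree M a = 0" using deg0[of M "insert a Z" a] M(1) lg_def' by blast
      ultimately show ?thesis using M unfolding lg_def' by (intro exI[of _ M]) auto
    qed
  qed
  define D where "D = G.under - G.over"
  have DA: "D \<subseteq> A - Z" by (auto simp: D_def G.under_def)
  have "2 + 2 * card Z \<le> 2 * card D" using G.nu_le_deficient nuZ nu0 by (simp add: D_def)
  then have ZD: "card Z < card D" by simp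
  have "common_nbrs E D \<subseteq> Z"
  proof
    fix b assume "b \<in> common_nbrs E D"
    then obtain x y where xy: "x \<in> D" "y \<in> D" "x \<noteq> y" "{x, b} \<in> E" "{y, b} \<in> E"
      by (auto simp: common_nbrs_def)
    show "b \<in> Z"
    proof (rule ccontr)
      assume "b \<notin> Z"
      then have "{x, b} \<in> EZ Z" "{y, b} \<in> EZ Z" using xy DA by (auto simp: EZ_def)
      then show False using G.deficient_unique[of x y b] xy by (simp add: D_def)
    qed
  qed
  then have "card (common_nbrs E D) \<le> card Z" using finZ card_mono by blast
  \<comment> \<open>The double Hall property leaves only one vertex in \<open>D\<close>, hence none
    in \<open>Z\<close>: the graph itself is critical.\<close>
  then have "\<not> 2 \<le> card D" using dHp[of D] DA ZD by auto
  then have "card D = 1" "card Z = 0" using ZD by auto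
  then obtain a where a: "D = {a}" and Z0: "Z = {}" using finZ by (auto simp: card_1_singleton_iff)
  have EZ0: "EZ Z = E" by (simp add: EZ_def Z0)
  have "\<exists>a'\<in>A. a' \<noteq> a"
  proof (rule ccontr)
    assume "\<not> ?thesis"
    then have "A \<subseteq> {a}" by blast
    then have "card A \<le> card {a}" by (intro card_mono) auto
    then show False using A2 by simp
  qed
  then obtain a' where a': "a' \<in> A" "a' \<noteq> a" by blast
  show False
  proof (rule G.deficient_not_singleton[of a a'])
    show "G.under - G.over = {a}" using a by (simp add: D_def)
    show "a' \<in> A - Z" "a' \<noteq> a" using a' Z0 by auto
    fix x y assume xy: "x \<in> A - Z" "y \<in> A - Z" "x \<noteq> y"
    have "2 \<le> card (common_nbrs E {x, y})" using dHp[of "{x, y}"] xy by simp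
    then obtain b c where "b \<in> common_nbrs E {x, y}" "c \<in> common_nbrs E {x, y}" "b \<noteq> c"
      by (metis card_2_iff' card_le_Suc0_iff_eq card.infinite le_zero_eq not_numeral_le_zero numeral_2_eq_2 not_less_eq_eq)
    then show "\<exists>b c. b \<noteq> c \<and> {x, b} \<in> EZ Z \<and> {y, b} \<in> EZ Z \<and> {x, c} \<in> EZ Z \<and> {y, c} \<in> EZ Z"
      unfolding EZ0 by (auto simp: common_nbrs_def)
  qed
qed

subsection \<open>Finite graphs\<close>

theorem (in two_factor_graph) ex_two_factor:
  assumes dHp: "\<And>X. X \<subseteq> A \<Longrightarrow> 2 \<le> card X \<Longrightarrow> card X \<le> card (common_nbrs E X)"
    and A2: "2 \<le> card A"
  shows "\<exists>M\<subseteq>E. (\<forall>a\<in>A. degree M a = 2) \<and> (\<forall>b. b \<notin> A \<longrightarrow> degree M b = 0 \<or> degree M b = 2)"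
proof -
  \<comment> \<open>The sum type supplies two fresh pendant vertices for each vertex of
    \<open>A\<close>, whatever the vertex type is.\<close>
  define A' :: "('v + 'v \<times> bool) set" where "A' = Inl ` A"
  define PE :: "('v + 'v \<times> bool) set set" where "PE = {{Inl a, Inr (a, i)} | a i. a \<in> A}"
  define E' where "E' = (`) Inl ` E \<union> PE"
  define p :: "'v + 'v \<times> bool \<Rightarrow> bool \<Rightarrow> 'v + 'v \<times> bool" where
    "p x i = Inr (projl x, i)" for x i
  have inl: "{Inl x, Inl y} \<in> E' \<longleftrightarrow> {x, y} \<in> E" for x y
  proof
    assume "{Inl x, Inl y} \<in> E'"
    then consider e where "e \<in> E" "{Inl x, Inl y} = (Inl :: 'v \<Rightarrow> 'v + 'v \<times> bool) ` e"
      | "{Inl x, Inl y} \<in> PE" by (auto simp: E'_def)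
    then show "{x, y} \<in> E"
    proof cases
      case (1 e)
      then have "(Inl :: 'v \<Rightarrow> 'v + 'v \<times> bool) ` e = Inl ` {x, y}" by simp
      then have "e = {x, y}" using inj_image_eq_iff[of Inl] inj_Inl by metis
      with 1 show ?thesis by simp
    qed (auto simp: PE_def doubleton_eq_iff)
  next
    assume "{x, y} \<in> E"
    then have "Inl ` {x, y} \<in> E'" unfolding E'_def by blast
    then show "{Inl x, Inl y} \<in> E'" by simp
  qed
  interpret G: two_factor_graph A' E'
  proof
    show "finite A'" using finite_A by (simp add: A'_def)
    have "PE = (\<lambda>(a, i). {Inl a, Inr (a, i)}) ` (A \<times> UNIV)" by (auto simp: PE_def)
    then show "finite E'" using finite_A finite_E by (simp add: E'_def)
    show "\<exists>a\<in>A'. \<exists>b. b \<notin> A' \<and> e = {a, b}" if "e \<in> E'" for e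
    proof -
      consider f where "f \<in> E" "e = Inl ` f" | a i where "a \<in> A" "e = {Inl a, Inr (a, i)}"
        using \<open>e \<in> E'\<close> by (auto simp: E'_def PE_def)
      then show ?thesis
      proof cases
        case (1 f)
        then obtain a b where "a \<in> A" "b \<notin> A" "f = {a, b}" using edge_cases by blast
        then have "Inl a \<in> A'" "Inl b \<notin> A'" "e = {Inl a, Inl b}" using 1 by (auto simp: A'_def)
        then show ?thesis by blast
      next
        case (2 a i)
        then show ?thesis by (auto simp: A'_def)
      qed
    qed
  qed
  have pend_only: "e = {Inl a, Inr (a, i)}" if "a \<in> A" "e \<in> E'" "Inr (a, i) \<in> e" for a e i
    using that by (auto simp: E'_def PE_def)
  have "\<exists>M. G.legit M \<and> odd_verts M = {}"
  proof (rule G.ex_two_factor_pendants[of p])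
    show "{a, p a i} \<in> E'" if "a \<in> A'" for a i
    proof -
      obtain x where "x \<in> A" "a = Inl x" using \<open>a \<in> A'\<close> by (auto simp: A'_def)
      then have "{a, p a i} \<in> PE" unfolding PE_def p_def by auto
      then show ?thesis by (simp add: E'_def)
    qed
    show "e = {a, p a i}" if "a \<in> A'" "e \<in> E'" "p a i \<in> e" for a e i
      using that pend_only[of "projl a" e i] by (auto simp: A'_def p_def)
    show "p a True \<noteq> p a False" for a by (simp add: p_def)
    show "2 \<le> card A'" using A2 by (simp add: A'_def card_image)
    fix X assume X: "X \<subseteq> A'" "2 \<le> card X"
    then obtain Y where Y: "Y \<subseteq> A" "X = Inl ` Y" unfolding A'_def by (meson subset_imageE)
    have cX: "card X = card Y" using Y(2) by (simp add: card_image)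
    have fin: "finite (common_nbrs E' X)"
    proof (rule finite_subset)
      show "common_nbrs E' X \<subseteq> \<Union>E'" by (auto simp: common_nbrs_def)
      have "finite e" if "e \<in> E'" for e using G.card_edge[OF that] card.infinite by fastforce
      then show "finite (\<Union>E')" using G.finite_E by blast
    qed
    have "card X \<le> card (common_nbrs E Y)" using dHp[OF Y(1)] X(2) cX by simp
    also have "\<dots> = card (Inl ` common_nbrs E Y :: ('v + 'v \<times> bool) set)" by (simp add: card_image)
    also have "\<dots> \<le> card (common_nbrs E' X)"
    proof (rule card_mono[OF fin])
      show "Inl ` common_nbrs E Y \<subseteq> common_nbrs E' X"
      proof
        fix v assume "v \<in> (Inl ` common_nbrs E Y :: ('v + 'v \<times> bool) set)"
        then obtain b x y where "v = Inl b" "x \<in> Y" "y \<in> Y" "x \<noteq> y" "{x, b} \<in> E" "{y, b} \<in> E"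
          by (auto simp: common_nbrs_def)
        then have "Inl x \<in> X" "Inl y \<in> X" "Inl x \<noteq> (Inl y :: 'v + 'v \<times> bool)"
          "{Inl x, v} \<in> E'" "{Inl y, v} \<in> E'" using Y(2) inl by auto
        then show "v \<in> common_nbrs E' X" unfolding common_nbrs_def by blast
      qed
    qed
    finally show "card X \<le> card (common_nbrs E' X)" .
  qed
  then obtain M' where M': "G.legit M'" "odd_verts M' = {}" by blast
  have M'E: "M' \<subseteq> E'" using G.legitD(1)[OF M'(1)] .
  have finM': "finite M'" using G.legitD(2)[OF M'(1)] .
  have even: "even (degree M' v)" for v using M'(2) by (auto simp: odd_verts_def)
  have noPE: "e \<notin> M'" if "e \<in> PE" for e
  proof
    assume e: "e \<in> M'"
    obtain a i where a: "a \<in> A" "e = {Inl a, Inr (a, i)}" using \<open>e \<in> PE\<close> by (auto simp: PE_def)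
    have "{f \<in> M'. Inr (a, i) \<in> f} = {e}" using pend_only[OF a(1)] a(2) e M'E by auto
    then have "degree M' (Inr (a, i)) = 1" by (simp add: degree_def)
    with even[of "Inr (a, i)"] show False by simp
  qed
  define M where "M = {e \<in> E. Inl ` e \<in> M'}"
  have deg: "degree M v = degree M' (Inl v)" for v
  proof -
    have "(`) Inl ` {e \<in> M. v \<in> e} = {e \<in> M'. Inl v \<in> e}"
    proof
      show "(`) Inl ` {e \<in> M. v \<in> e} \<subseteq> {e \<in> M'. Inl v \<in> e}" by (auto simp: M_def)
      show "{e \<in> M'. Inl v \<in> e} \<subseteq> (`) Inl ` {e \<in> M. v \<in> e}"
      proof
        fix e assume "e \<in> {e \<in> M'. Inl v \<in> e}"
        then have e: "e \<in> M'" "Inl v \<in> e" by auto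
        then have "e \<in> (`) Inl ` E" using noPE M'E by (auto simp: E'_def)
        then obtain f where f: "f \<in> E" "e = Inl ` f" by blast
        then have "f \<in> M" "v \<in> f" using e by (auto simp: M_def)
        then show "e \<in> (`) Inl ` {e \<in> M. v \<in> e}" using f by blast
      qed
    qed
    moreover have "inj_on ((`) Inl) {e \<in> M. v \<in> e}" using inj_Inl by (auto simp: inj_on_def inj_image_eq_iff)
    ultimately show ?thesis unfolding degree_def by (metis card_image)
  qed
  have "degree M a = 2" if "a \<in> A" for a using G.legitD(3)[OF M'(1), of "Inl a"] that by (simp add: deg A'_def)
  moreover have "degree M b = 0 \<or> degree M b = 2" for b
  proof -
    have "degree M b \<le> 2" "even (degree M b)" using G.legitD(5)[OF M'(1)] even by (simp_all add: deg)
    then show ?thesis by (cases "degree M b = 1") auto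
  qed
  moreover have "M \<subseteq> E" by (auto simp: M_def)
  ultimately show ?thesis by blast
qed

subsection \<open>Infinite graphs\<close>

text \<open>A greedy construction with the whole history as argument, so that a choice can avoid all
  earlier ones. The choice must exist for every list, also for histories that never occur; this
  shapes the predicates used with it.\<close>

lemma dependent_list_choice:
  assumes "\<And>xs. \<exists>x. P xs x"
  shows "\<exists>f. \<forall>n. P (map f [0..<n]) (f n)"
proof -
  define g where "g xs = (SOME x. P xs x)" for xs
  have g: "P xs (g xs)" for xs unfolding g_def using assms by (rule someI_ex)
  define F where "F = rec_nat [] (\<lambda>_ xs. xs @ [g xs])"
  have F: "F 0 = []" "F (Suc n) = F n @ [g (F n)]" for n by (simp_all add: F_def)
  define f where "f n = g (F n)" for n
  have "F n = map f [0..<n]" for n by (induction n) (simp_all add: F f_def)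
  then have "\<forall>n. P (map f [0..<n]) (f n)" using g by (simp add: f_def)
  then show ?thesis by blast
qed

section \<open>Edge relations: moving edges and taking limits\<close>

definition right :: "('a \<times> 'b) set \<Rightarrow> 'a \<Rightarrow> 'b set" where
  "right m a = {b. (a, b) \<in> m}"

definition left :: "('a \<times> 'b) set \<Rightarrow> 'b \<Rightarrow> 'a set" where
  "left m b = {a. (a, b) \<in> m}"

lemma mem_right_left [simp]: "b \<in> right m a \<longleftrightarrow> (a, b) \<in> m" "a \<in> left m b \<longleftrightarrow> (a, b) \<in> m"
  by (auto simp: right_def left_def)

text \<open>All edges \<open>(x n, y n)\<close> are moved to \<open>(x n, z n)\<close> at once.
  Injectivity of \<open>x\<close> means that each left end exchanges at most one edge; injectivity
  of \<open>y\<close> and \<open>z\<close> means that each right end loses and gains at most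
  one.\<close>

lemma rewire:
  fixes m r :: "('a \<times> 'b) set" and x :: "'i \<Rightarrow> 'a" and y z :: "'i \<Rightarrow> 'b"
  assumes "m \<subseteq> r" and fin: "\<And>a. finite (right m a)" "\<And>b. finite (left m b)"
    and inj: "inj_on x J" "inj_on y J" "inj_on z J"
    and xy: "\<And>n. n \<in> J \<Longrightarrow> (x n, y n) \<in> m" and xz: "\<And>n. n \<in> J \<Longrightarrow> (x n, z n) \<in> r - m"
  obtains m' where "m' \<subseteq> r" "\<And>a. card (right m' a) = card (right m a)" "\<And>b. finite (left m' b)"
    "\<And>b. card (left m' b) + of_bool (b \<in> y ` J) = card (left m b) + of_bool (b \<in> z ` J)"
proof -
  define m' where "m' = (m - (\<lambda>n. (x n, y n)) ` J) \<union> (\<lambda>n. (x n, z n)) ` J"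
  have sub: "m' \<subseteq> r" using assms(1) xz by (auto simp: m'_def)
  have mem: "(a, b) \<in> m' \<longleftrightarrow> (a, b) \<in> m \<and> \<not> (\<exists>k\<in>J. a = x k \<and> b = y k) \<or> (\<exists>k\<in>J. a = x k \<and> b = z k)" for a b
    by (auto simp: m'_def)
  have 1: "card (right m' a) = card (right m a)" for a
  proof (cases "a \<in> x ` J")
    case True
    then obtain n where n: "n \<in> J" "a = x n" by blast
    have "(\<exists>k\<in>J. a = x k \<and> b = g k) \<longleftrightarrow> b = g n" for b and g :: "'i \<Rightarrow> 'b"
      using n inj_onD[OF inj(1)] by blast
    then have "right m' a = insert (z n) (right m a - {y n})" by (auto simp: mem)
    moreover have "y n \<in> right m a" "z n \<notin> right m a" using xy xz n by auto
    moreover from this have "card (right m a) = Suc (card (right m a - {y n}))"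
      using fin(1)[of a] by (intro card.remove)
    ultimately show ?thesis using fin(1)[of a] by simp
  next
    case False
    then have "right m' a = right m a" by (auto simp: m'_def)
    then show ?thesis by simp
  qed
  have L: "left m' b = (left m b - {x n | n. n \<in> J \<and> y n = b}) \<union> {x n | n. n \<in> J \<and> z n = b}" for b
    by (rule set_eqI) (simp only: mem_right_left mem Un_iff Diff_iff mem_Collect_eq, blast)
  have 2: "finite (left m' b)" for b
  proof -
    have "{x n | n. n \<in> J \<and> z n = b} \<subseteq> x ` {n \<in> J. z n = b}" by auto
    moreover have "finite {n \<in> J. z n = b}"
    proof (cases "\<exists>k\<in>J. z k = b")
      case True
      then obtain k where "k \<in> J" "z k = b" by blast
      then have "{n \<in> J. z n = b} \<subseteq> {k}" using inj(3) by (auto simp: inj_on_def)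
      then show ?thesis using finite_subset by blast
    next
      case False
      then have "{n \<in> J. z n = b} = {}" by blast
      then show ?thesis by (simp only: finite.emptyI)
    qed
    ultimately have "finite {x n | n. n \<in> J \<and> z n = b}" using finite_subset by blast
    then show ?thesis using fin(2)[of b] by (simp add: L)
  qed
  have 3: "card (left m' b) + of_bool (b \<in> y ` J) = card (left m b) + of_bool (b \<in> z ` J)" for b
  proof -
    define R where "R = left m b - {x n | n. n \<in> J \<and> y n = b}"
    have R: "card R + of_bool (b \<in> y ` J) = card (left m b)"
    proof (cases "b \<in> y ` J")
      case True
      then obtain n where n: "n \<in> J" "b = y n" by blast
      then have "R = left m b - {x n}" using inj(2) by (auto simp: R_def inj_on_def)
      moreover have "x n \<in> left m b" using n xy by simp
      moreover from this have "card (left m b) = Suc (card (left m b - {x n}))"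
        using fin(2)[of b] by (intro card.remove)
      ultimately show ?thesis using True by simp
    next
      case False
      then have "R = left m b" by (auto simp: R_def)
      then show ?thesis using False by simp
    qed
    have finR: "finite R" using fin(2)[of b] by (simp add: R_def)
    have LR: "left m' b = R \<union> {x n | n. n \<in> J \<and> z n = b}" by (simp add: L R_def)
    have "card (left m' b) = card R + of_bool (b \<in> z ` J)"
    proof (cases "b \<in> z ` J")
      case True
      then obtain n where n: "n \<in> J" "b = z n" by blast
      then have "{x n | n. n \<in> J \<and> z n = b} = {x n}" using inj(3) by (auto simp: inj_on_def)
      then have "left m' b = insert (x n) R" unfolding LR by simp
      moreover have "x n \<notin> R" using n xz by (auto simp: R_def)
      ultimately show ?thesis using True finR by simp
    next
      case False
      then have "left m' b = R" unfolding LR by blast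
      then show ?thesis using False by simp
    qed
    with R show ?thesis by simp
  qed
  show ?thesis by (rule that[OF sub 1 2 3])
qed

text \<open>The pairs of \<open>r\<close> are enumerated and decided one at a time, as in Konig's
  lemma, keeping infinitely many \<open>M n\<close> in agreement with all decisions. Infinitely
  many, so that agreement can be demanded at arbitrarily late stages.\<close>

lemma compactness_limit:
  assumes r: "countable r"
  obtains m where "m \<subseteq> r" "\<And>F. finite F \<Longrightarrow> F \<subseteq> r \<Longrightarrow> infinite {n::nat. \<forall>e\<in>F. e \<in> M n \<longleftrightarrow> e \<in> m}"
proof -
  define e where "e = from_nat_into r"
  define S where "S xs = {n. \<forall>i<length xs. (e i \<in> M n) = xs ! i}" for xs
  have "\<exists>x. infinite (S xs) \<longrightarrow> infinite (S (xs @ [x]))" for xs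
  proof -
    have "S xs \<subseteq> S (xs @ [True]) \<union> S (xs @ [False])"
      by (auto simp: S_def nth_append less_Suc_eq)
    then show ?thesis by (metis finite_Un finite_subset)
  qed
  then obtain f where f: "\<And>n. infinite (S (map f [0..<n])) \<longrightarrow> infinite (S (map f [0..<n] @ [f n]))"
    using dependent_list_choice[of "\<lambda>xs x. infinite (S xs) \<longrightarrow> infinite (S (xs @ [x]))"] by blast
  have inf: "infinite (S (map f [0..<n]))" for n
  proof (induction n)
    case 0
    then show ?case by (simp add: S_def)
  next
    case (Suc n)
    then show ?case using f[of n] by simp
  qed
  define m where "m = {x \<in> r. f (to_nat_on r x)}"
  have "infinite {n. \<forall>x\<in>F. x \<in> M n \<longleftrightarrow> x \<in> m}" if F: "finite F" "F \<subseteq> r" for F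
  proof -
    obtain k where k: "\<And>x. x \<in> F \<Longrightarrow> to_nat_on r x < k"
      using finite_nat_set_iff_bounded[of "to_nat_on r ` F"] F(1) by auto
    have "S (map f [0..<k]) \<subseteq> {n. \<forall>x\<in>F. x \<in> M n \<longleftrightarrow> x \<in> m}"
    proof (intro subsetI CollectI ballI)
      fix n x assume n: "n \<in> S (map f [0..<k])" and x: "x \<in> F"
      then have "(e (to_nat_on r x) \<in> M n) = f (to_nat_on r x)" using k[OF x] by (simp add: S_def)
      moreover have "e (to_nat_on r x) = x" using r x F(2) by (auto simp: e_def)
      ultimately show "x \<in> M n \<longleftrightarrow> x \<in> m" using x F(2) by (auto simp: m_def)
    qed
    then show ?thesis using inf finite_subset by blast
  qed
  moreover have "m \<subseteq> r" by (auto simp: m_def)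
  ultimately show ?thesis using that by blast
qed

section \<open>Cofinite vertices and countability\<close>

locale cofinite_dHp =
  fixes A :: "'a set" and r :: "('a \<times> 'a) set"
  assumes inf_A: "infinite A"
    and sides: "(a, b) \<in> r \<Longrightarrow> a \<in> A \<and> b \<notin> A"
    and fin_right: "finite (right r a)"
    and fin_cofin: "finite (left r b) \<or> finite (A - left r b)"
    and inf_dHp: "X \<subseteq> A \<Longrightarrow> infinite X \<Longrightarrow> infinite {b. \<exists>x\<in>X. \<exists>y\<in>X. x \<noteq> y \<and> (x, b) \<in> r \<and> (y, b) \<in> r}"
    and fin_dHp: "X \<subseteq> A \<Longrightarrow> 2 \<le> card X \<Longrightarrow>
      card X \<le> card {b. \<exists>x\<in>X. \<exists>y\<in>X. x \<noteq> y \<and> (x, b) \<in> r \<and> (y, b) \<in> r}"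
begin

definition cofin :: "'a set" where
  "cofin = {b. infinite (left r b)}"

lemma cofinD: "c \<in> cofin \<Longrightarrow> finite (A - left r c)"
  using fin_cofin by (auto simp: cofin_def)

text \<open>Otherwise an infinite set of vertices of \<open>A\<close>, no two of which share a neighbour of finite
  degree, would have only finitely many common neighbours.\<close>

lemma infinite_cofin: "infinite cofin"
proof
  assume fin: "finite cofin"
  \<comment> \<open>The vertices sharing a neighbour of finite degree with \<open>a\<close>. There
    are finitely many of them, so a greedy choice in \<open>A\<close> never stops.\<close>
  define near where "near a = (\<Union>b\<in>right r a - cofin. left r b)" for a
  have fin_near: "finite (near a)" for a
    unfolding near_def using fin_right by (auto simp: cofin_def)
  have "\<exists>x. x \<in> A \<and> x \<notin> set xs \<and> (\<forall>y\<in>set xs. x \<notin> near y)" for xs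
  proof -
    have "finite (set xs \<union> (\<Union>y\<in>set xs. near y))" using fin_near by simp
    then have "infinite (A - (set xs \<union> (\<Union>y\<in>set xs. near y)))" using inf_A by (rule Diff_infinite_finite)
    then obtain x where "x \<in> A - (set xs \<union> (\<Union>y\<in>set xs. near y))" by (metis finite.emptyI ex_in_conv)
    then show ?thesis by blast
  qed
  then have "\<exists>f. \<forall>n. f n \<in> A \<and> f n \<notin> set (map f [0..<n]) \<and> (\<forall>y\<in>set (map f [0..<n]). f n \<notin> near y)"
    by (rule dependent_list_choice)
  then obtain f where f0: "\<And>n. f n \<in> A \<and> f n \<notin> set (map f [0..<n]) \<and> (\<forall>y\<in>set (map f [0..<n]). f n \<notin> near y)"
    by blast
  have f: "f n \<in> A" "i < n \<Longrightarrow> f n \<noteq> f i" "i < n \<Longrightarrow> f n \<notin> near (f i)" for n i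
    using f0[of n] by auto
  have "inj f" by (metis f(2) injI linorder_neqE_nat)
  then have "infinite (range f)" using finite_imageD infinite_UNIV_nat by blast
  moreover have "range f \<subseteq> A" using f(1) by blast
  ultimately have "infinite {b. \<exists>x\<in>range f. \<exists>y\<in>range f. x \<noteq> y \<and> (x, b) \<in> r \<and> (y, b) \<in> r}"
    using inf_dHp by blast
  moreover have "{b. \<exists>x\<in>range f. \<exists>y\<in>range f. x \<noteq> y \<and> (x, b) \<in> r \<and> (y, b) \<in> r} \<subseteq> cofin"
  proof
    fix b assume "b \<in> {b. \<exists>x\<in>range f. \<exists>y\<in>range f. x \<noteq> y \<and> (x, b) \<in> r \<and> (y, b) \<in> r}"
    then obtain i j where ij: "f i \<noteq> f j" "(f i, b) \<in> r" "(f j, b) \<in> r" by blast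
    show "b \<in> cofin"
    proof (rule ccontr)
      assume "b \<notin> cofin"
      then have "f j \<in> near (f i)" "f i \<in> near (f j)" using ij by (auto simp: near_def)
      then show False using f(3)[of i j] f(3)[of j i] ij(1) by (metis linorder_neqE_nat)
    qed
  qed
  ultimately show False using fin finite_subset by blast
qed

text \<open>A vertex has finite degree, so it misses some member of a fixed sequence of cofinite
  vertices; each member is missed by finitely many vertices only.\<close>

lemma countable_A: "countable A"
proof -
  obtain c :: "nat \<Rightarrow> 'a" where c: "inj c" "range c \<subseteq> cofin"
    using infinite_cofin infinite_countable_subset by blast
  have "A \<subseteq> (\<Union>n. A - left r (c n))"
  proof
    fix a assume a: "a \<in> A"
    show "a \<in> (\<Union>n. A - left r (c n))"
    proof (rule ccontr)
      assume "a \<notin> (\<Union>n. A - left r (c n))"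
      then have "range c \<subseteq> right r a" using a by auto
      then show False using fin_right c(1) by (metis finite_imageD finite_subset infinite_UNIV_nat)
    qed
  qed
  moreover have "countable (\<Union>n. A - left r (c n))"
  proof (rule countable_UN)
    fix n
    have "c n \<in> cofin" using c(2) by blast
    then show "countable (A - left r (c n))" using cofinD countable_finite by blast
  qed simp
  ultimately show ?thesis by (rule countable_subset)
qed

lemma countable_r: "countable r"
proof -
  have "r \<subseteq> (\<Union>a\<in>A. (\<lambda>b. (a, b)) ` right r a)" using sides by force
  moreover have "countable (\<Union>a\<in>A. (\<lambda>b. (a, b)) ` right r a)"
    using countable_A fin_right by (intro countable_UN) (auto intro: countable_finite)
  ultimately show ?thesis by (rule countable_subset)
qed

section \<open>Limits of finite solutions\<close>

lemma finite_stage: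
  assumes X: "finite X" "X \<subseteq> A" "2 \<le> card X"
  shows "\<exists>m\<subseteq>r. (\<forall>a\<in>X. card (right m a) = 2) \<and>
    (\<forall>b. finite (left m b) \<and> (card (left m b) = 0 \<or> card (left m b) = 2))"
proof -
  \<comment> \<open>All edges at \<open>X\<close> are kept, so subsets of \<open>X\<close> have the
    same common neighbours as in the infinite graph.\<close>
  define E where "E = (\<lambda>(a, b). {a, b}) ` {(a, b) \<in> r. a \<in> X}"
  have E: "{a, b} \<in> E \<longleftrightarrow> (a, b) \<in> r" if "a \<in> X" for a b
  proof
    assume "{a, b} \<in> E"
    then obtain a' b' where *: "(a', b') \<in> r" "a' \<in> X" "{a, b} = {a', b'}" by (auto simp: E_def)
    then have "b' \<notin> A" "a' \<in> A" "a \<in> A" using sides that X(2) by blast+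
    then show "(a, b) \<in> r" using * by (auto simp: doubleton_eq_iff)
  next
    assume "(a, b) \<in> r"
    then show "{a, b} \<in> E" using that by (auto simp: E_def)
  qed
  have "{(a, b) \<in> r. a \<in> X} = Sigma X (right r)" by auto
  then have finE: "finite E" unfolding E_def using X(1) fin_right by simp
  interpret two_factor_graph X E
  proof
    show "finite X" "finite E" using X finE by auto
    show "\<exists>a\<in>X. \<exists>b. b \<notin> X \<and> e = {a, b}" if "e \<in> E" for e
      using that sides X(2) by (fastforce simp: E_def)
  qed
  have "\<exists>M\<subseteq>E. (\<forall>a\<in>X. degree M a = 2) \<and> (\<forall>b. b \<notin> X \<longrightarrow> degree M b = 0 \<or> degree M b = 2)"
  proof (rule ex_two_factor)
    fix Y assume Y: "Y \<subseteq> X" "2 \<le> card Y"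
    have "common_nbrs E Y = {b. \<exists>x\<in>Y. \<exists>y\<in>Y. x \<noteq> y \<and> (x, b) \<in> r \<and> (y, b) \<in> r}"
      using E Y(1) unfolding common_nbrs_def by blast
    then show "card Y \<le> card (common_nbrs E Y)" using fin_dHp[of Y] Y X(2) by auto
  qed (use X in auto)
  then obtain M where M: "M \<subseteq> E" "\<And>a. a \<in> X \<Longrightarrow> degree M a = 2"
    "\<And>b. b \<notin> X \<Longrightarrow> degree M b = 0 \<or> degree M b = 2" by blast
  define m where "m = {(a, b) \<in> r. a \<in> X \<and> {a, b} \<in> M}"
  have edge: "\<exists>a b. e = {a, b} \<and> (a, b) \<in> m" if "e \<in> M" for e
  proof -
    have "e \<in> E" using that M(1) by blast
    then obtain a b where "(a, b) \<in> r" "a \<in> X" "e = {a, b}" by (auto simp: E_def)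
    then show ?thesis using \<open>e \<in> M\<close> by (auto simp: m_def)
  qed
  have mA: "a \<in> A" "b \<notin> A" "{a, b} \<in> M" "a \<in> X" if "(a, b) \<in> m" for a b using that sides by (auto simp: m_def)
  have "card (right m a) = 2" if a: "a \<in> X" for a
  proof -
    have "(\<lambda>b. {a, b}) ` right m a = {e \<in> M. a \<in> e}"
    proof
      show "(\<lambda>b. {a, b}) ` right m a \<subseteq> {e \<in> M. a \<in> e}" using mA by auto
      show "{e \<in> M. a \<in> e} \<subseteq> (\<lambda>b. {a, b}) ` right m a"
      proof
        fix e assume e: "e \<in> {e \<in> M. a \<in> e}"
        then obtain a' b where ab: "e = {a', b}" "(a', b) \<in> m" using edge by blast
        have "b \<notin> A" using mA ab by blast
        then have "a = a'" using e ab a X(2) by auto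
        then show "e \<in> (\<lambda>b. {a, b}) ` right m a" using ab by auto
      qed
    qed
    moreover have "inj_on (\<lambda>b. {a, b}) (right m a)" by (auto simp: inj_on_def doubleton_eq_iff)
    ultimately have "card (right m a) = degree M a" unfolding degree_def by (metis card_image)
    then show ?thesis using M(2)[OF a] by simp
  qed
  moreover have "finite (left m b) \<and> (card (left m b) = 0 \<or> card (left m b) = 2)" for b
  proof
    have "left m b \<subseteq> X" using mA by auto
    then show fin: "finite (left m b)" using X(1) finite_subset by blast
    show "card (left m b) = 0 \<or> card (left m b) = 2"
    proof (cases "b \<in> A")
      case True
      then have "left m b = {}" using mA by auto
      then show ?thesis by simp
    next
      case False
      have "(\<lambda>a. {a, b}) ` left m b = {e \<in> M. b \<in> e}"
      proof
        show "(\<lambda>a. {a, b}) ` left m b \<subseteq> {e \<in> M. b \<in> e}" using mA by auto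
        show "{e \<in> M. b \<in> e} \<subseteq> (\<lambda>a. {a, b}) ` left m b"
        proof
          fix e assume e: "e \<in> {e \<in> M. b \<in> e}"
          then obtain a b' where ab: "e = {a, b'}" "(a, b') \<in> m" using edge by blast
          have "a \<in> A" using mA ab by blast
          then have "b = b'" using e ab False by auto
          then show "e \<in> (\<lambda>a. {a, b}) ` left m b" using ab by auto
        qed
      qed
      moreover have "inj_on (\<lambda>a. {a, b}) (left m b)" by (auto simp: inj_on_def doubleton_eq_iff)
      ultimately have "card (left m b) = degree M b" unfolding degree_def by (metis card_image)
      then show ?thesis using M(3)[of b] False X(2) by auto
    qed
  qed
  moreover have "m \<subseteq> r" by (auto simp: m_def)
  ultimately show ?thesis by blast
qed

definition near_factor :: "('a \<times> 'a) set \<Rightarrow> bool" where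
  "near_factor m \<longleftrightarrow> m \<subseteq> r \<and> (\<forall>a\<in>A. card (right m a) = 2) \<and>
     (\<forall>b. finite (left m b) \<and> card (left m b) \<le> 2) \<and> (\<forall>b. card (left m b) = 1 \<longrightarrow> b \<in> cofin)"

text \<open>At a vertex of finite degree some late stage agrees with the limit on every edge, so its
  degree survives. At a cofinite vertex agreement holds only on finite sets of edges: degrees above
  2 are excluded, but degree 1 is not.\<close>

lemma ex_near_factor: "\<exists>m. near_factor m"
proof -
  define \<alpha> where "\<alpha> = from_nat_into A"
  have \<alpha>: "bij_betw \<alpha> UNIV A" unfolding \<alpha>_def using countable_A inf_A by (rule bij_betw_from_nat_into)
  \<comment> \<open>The summand 2 gives even the first set the two elements required by
    \<open>finite_stage\<close>.\<close>
  define X where "X n = \<alpha> ` {..<n + 2}" for n :: nat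
  have inj: "inj \<alpha>" using \<alpha> by (simp add: bij_betw_def)
  have "\<exists>m\<subseteq>r. (\<forall>a\<in>X n. card (right m a) = 2) \<and>
    (\<forall>b. finite (left m b) \<and> (card (left m b) = 0 \<or> card (left m b) = 2))" for n
  proof (rule finite_stage)
    show "finite (X n)" by (simp add: X_def)
    show "X n \<subseteq> A" using \<alpha> by (auto simp: X_def bij_betw_def)
    have "card (X n) = n + 2" unfolding X_def using inj by (subst card_image) (auto intro: inj_on_subset)
    then show "2 \<le> card (X n)" by simp
  qed
  then obtain M where M: "\<And>n. M n \<subseteq> r" "\<And>n a. a \<in> X n \<Longrightarrow> card (right (M n) a) = 2"
    "\<And>n b. finite (left (M n) b)" "\<And>n b. card (left (M n) b) = 0 \<or> card (left (M n) b) = 2"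
    by metis
  obtain m where m: "m \<subseteq> r"
    "\<And>F. finite F \<Longrightarrow> F \<subseteq> r \<Longrightarrow> infinite {n. \<forall>e\<in>F. e \<in> M n \<longleftrightarrow> e \<in> m}"
    using compactness_limit[OF countable_r, of M] by blast
  have agree: "\<exists>n\<ge>k. \<forall>e\<in>F. e \<in> M n \<longleftrightarrow> e \<in> m" if "finite F" "F \<subseteq> r" for F k
    using m(2)[OF that] by (auto simp: infinite_nat_iff_unbounded_le)
  have "card (right m a) = 2" if a: "a \<in> A" for a
  proof -
    obtain k where k: "a = \<alpha> k" using \<alpha> a by (auto simp: bij_betw_def)
    have "finite (Pair a ` right r a)" "Pair a ` right r a \<subseteq> r" using fin_right by auto
    then obtain n where n: "n \<ge> k" "\<forall>e\<in>Pair a ` right r a. e \<in> M n \<longleftrightarrow> e \<in> m"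
      using agree by blast
    have "right m a = right (M n) a" using n(2) m(1) M(1)[of n] by auto
    moreover have "a \<in> X n" using k n(1) by (auto simp: X_def)
    ultimately show ?thesis using M(2) by simp
  qed
  moreover have small: "card T \<le> 2" if T: "finite T" "T \<subseteq> left m b" for T b
  proof -
    have Tm: "(a, b) \<in> m" if "a \<in> T" for a using T(2) that by (metis mem_right_left(2) subsetD)
    then have "finite ((\<lambda>a. (a, b)) ` T)" "(\<lambda>a. (a, b)) ` T \<subseteq> r" using T(1) m(1) by auto
    then obtain n where n: "\<forall>e\<in>(\<lambda>a. (a, b)) ` T. e \<in> M n \<longleftrightarrow> e \<in> m" using agree[of _ 0] by blast
    then have "T \<subseteq> left (M n) b" using Tm by auto
    then have "card T \<le> card (left (M n) b)" using M(3) card_mono by blast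
    then show ?thesis using M(4)[of n b] by auto
  qed
  moreover have fin: "finite (left m b)" for b
  proof (rule ccontr)
    assume "infinite (left m b)"
    then obtain T where "T \<subseteq> left m b" "finite T" "card T = 3" using infinite_arbitrarily_large by blast
    then show False using small[of T b] by simp
  qed
  moreover have "b \<in> cofin" if b: "card (left m b) = 1" for b
  proof (rule ccontr)
    assume "b \<notin> cofin"
    then have "finite ((\<lambda>a. (a, b)) ` left r b)" "(\<lambda>a. (a, b)) ` left r b \<subseteq> r" by (auto simp: cofin_def)
    then obtain n where n: "\<forall>e\<in>(\<lambda>a. (a, b)) ` left r b. e \<in> M n \<longleftrightarrow> e \<in> m" using agree[of _ 0] by blast
    then have "left m b = left (M n) b" using m(1) M(1)[of n] by auto
    then show False using b M(4)[of n b] by auto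
  qed
  ultimately show ?thesis unfolding near_factor_def using m(1) by blast
qed

lemma near_factorD:
  assumes "near_factor m"
  shows "m \<subseteq> r" "a \<in> A \<Longrightarrow> card (right m a) = 2" "finite (left m b)" "card (left m b) \<le> 2"
    "card (left m b) = 1 \<Longrightarrow> b \<in> cofin" "finite (right m a)"
proof -
  show "m \<subseteq> r" using assms by (simp add: near_factor_def)
  then have "right m a \<subseteq> right r a" by auto
  then show "finite (right m a)" using fin_right finite_subset by blast
qed (use assms in \<open>auto simp: near_factor_def\<close>)

section \<open>Repairing defects at cofinite vertices\<close>

lemma pick_edge:
  assumes m: "near_factor m" and "infinite S" "\<And>b. b \<in> S \<Longrightarrow> card (left m b) > 0"
    and "finite Fa" "finite Fb" and c: "c \<in> cofin"
  shows "\<exists>a b. b \<in> S - Fb \<and> a \<notin> Fa \<and> (a, b) \<in> m \<and> (a, c) \<in> r - m"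
proof (rule ccontr)
  assume none: "\<not> ?thesis"
  \<comment> \<open>The forbidden left ends: those in \<open>Fa\<close>, the non-neighbours of
    \<open>c\<close>, and those already joined to \<open>c\<close>. They are finitely many and have
    finitely many edges in \<open>m\<close>, which cannot meet all of the infinite set
    \<open>S - Fb\<close>.\<close>
  let ?F = "Fa \<union> (A - left r c) \<union> left m c"
  have fin: "finite ?F" using assms(4) cofinD[OF c] near_factorD(3)[OF m] by simp
  have "S - Fb \<subseteq> (\<Union>a\<in>?F. right m a)"
  proof
    fix b assume b: "b \<in> S - Fb"
    then have "left m b \<noteq> {}" using assms(3) by fastforce
    then obtain a where a: "(a, b) \<in> m" by auto
    then have "a \<in> A" using near_factorD(1)[OF m] sides by blast
    then have "a \<in> ?F" using none a b by auto
    then show "b \<in> (\<Union>a\<in>?F. right m a)" using a by auto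
  qed
  then have "finite (S - Fb)" using fin near_factorD(6)[OF m] by (meson finite_UN_I finite_subset)
  then show False using assms(2,5) by simp
qed

text \<open>Infinitely many odd vertices are paired up: the edge of one member of a pair is handed over
  to the other one.\<close>

lemma repair_infinite:
  assumes m: "near_factor m" and inf: "infinite {b. card (left m b) = 1}"
  shows "\<exists>m\<subseteq>r. (\<forall>a\<in>A. card (right m a) = 2) \<and> (\<forall>b. finite (left m b) \<and> card (left m b) \<in> {0, 2})"
proof -
  define Od where "Od = {b. card (left m b) = 1}"
  have "Od \<subseteq> snd ` r"
  proof
    fix b assume "b \<in> Od"
    then have "left m b \<noteq> {}" by (auto simp: Od_def)
    then show "b \<in> snd ` r" using near_factorD(1)[OF m] by force
  qed
  then have "countable Od" using countable_r by (meson countable_image countable_subset)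
  then have bij: "bij_betw (from_nat_into Od) UNIV Od" using inf by (intro bij_betw_from_nat_into) (auto simp: Od_def)
  define od where "od = from_nat_into Od"
  have od: "range od = Od" using bij by (simp add: od_def bij_betw_def)
  define used :: "('a \<times> 'a \<times> 'a) option list \<Rightarrow> 'a set" where
    "used xs = {b. \<exists>a t. Some (a, b, t) \<in> set xs} \<union> {t. \<exists>a b. Some (a, b, t) \<in> set xs}" for xs
  define as :: "('a \<times> 'a \<times> 'a) option list \<Rightarrow> 'a set" where
    "as xs = {a. \<exists>b t. Some (a, b, t) \<in> set xs}" for xs
  have fin: "finite (used xs)" "finite (as xs)" for xs
  proof -
    have "used xs \<subseteq> (fst \<circ> snd \<circ> the) ` set xs \<union> (snd \<circ> snd \<circ> the) ` set xs" by (force simp: used_def)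
    then show "finite (used xs)" by (rule finite_subset) simp
    have "as xs \<subseteq> (fst \<circ> the) ` set xs" by (force simp: as_def)
    then show "finite (as xs)" by (rule finite_subset) simp
  qed
  \<comment> \<open>Stage \<open>n\<close> treats the \<open>n\<close>-th odd vertex
    \<open>c\<close>, unless it has already given or received an edge. A fresh odd donor
    \<open>b\<close> hands over an edge, ending with degree 0 while \<open>c\<close> gets degree 2.
    Left ends are not reused, as \<open>rewire\<close> needs \<open>x\<close> injective.\<close>
  define P where "P xs x \<longleftrightarrow> (let c = od (length xs) in if c \<in> used xs then x = None
     else \<exists>a b. x = Some (a, b, c) \<and> b \<in> Od \<and> b \<notin> used xs \<and> b \<noteq> c \<and> a \<notin> as xs \<and>
       (a, b) \<in> m \<and> (a, c) \<in> r - m)" for xs x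
  have "\<exists>x. P xs x" for xs
  proof (cases "od (length xs) \<in> used xs")
    case False
    let ?c = "od (length xs)"
    have c: "?c \<in> cofin" using od near_factorD(5)[OF m] by (auto simp: Od_def)
    have "\<exists>a b. b \<in> Od - insert ?c (used xs) \<and> a \<notin> as xs \<and> (a, b) \<in> m \<and> (a, ?c) \<in> r - m"
      by (rule pick_edge[OF m]) (use inf fin c in \<open>auto simp: Od_def\<close>)
    then obtain a b where "b \<in> Od - insert ?c (used xs)" "a \<notin> as xs" "(a, b) \<in> m" "(a, ?c) \<in> r - m"
      by blast
    then have "P xs (Some (a, b, ?c))" using False by (auto simp: P_def Let_def)
    then show ?thesis by blast
  qed (auto simp: P_def Let_def)
  then obtain f where f: "\<And>n. P (map f [0..<n]) (f n)" using dependent_list_choice[of P] by blast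
  define J where "J = {n. f n \<noteq> None}"
  define x where "x n = fst (the (f n))" for n
  define y where "y n = fst (snd (the (f n)))" for n
  define h where "h n = map f [0..<n]" for n
  have len: "length (h n) = n" for n by (simp add: h_def)
  have notJ: "od n \<in> used (h n)" if "n \<notin> J" for n
    using f[of n] that unfolding P_def h_def[symmetric] len J_def Let_def by (auto split: if_splits)
  have J: "f n = Some (x n, y n, od n)" "od n \<notin> used (h n)" "y n \<in> Od" "y n \<notin> used (h n)" "y n \<noteq> od n"
    "x n \<notin> as (h n)" "(x n, y n) \<in> m" "(x n, od n) \<in> r - m" if "n \<in> J" for n
    using f[of n] that unfolding P_def h_def[symmetric] len J_def Let_def x_def y_def
    by (auto split: if_splits)
  have mono: "y i \<in> used (h n)" "od i \<in> used (h n)" "x i \<in> as (h n)" if "i < n" "i \<in> J" for i n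
  proof -
    have "Some (x i, y i, od i) \<in> set (h n)" using J(1)[OF that(2)] that(1) by (force simp: h_def)
    then show "y i \<in> used (h n)" "od i \<in> used (h n)" "x i \<in> as (h n)" by (auto simp: used_def as_def)
  qed
  have used_cases: "\<exists>i\<in>J. c = y i \<or> c = od i" if "c \<in> used (h n)" for c n
  proof -
    obtain a b t where abt: "Some (a, b, t) \<in> set (h n)" "c = b \<or> c = t"
      using \<open>c \<in> used (h n)\<close> unfolding used_def by blast
    then obtain i where i: "f i = Some (a, b, t)" by (auto simp: h_def image_iff)
    then have iJ: "i \<in> J" by (simp add: J_def)
    then show ?thesis using J(1)[OF iJ] i abt(2) by auto
  qed
  have neq: "i = j" if "i \<in> J" "j \<in> J" "x i = x j \<or> y i = y j \<or> od i = od j" for i j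
  proof (rule ccontr)
    assume "i \<noteq> j"
    then consider "i < j" | "j < i" by linarith
    then show False using mono[of i j] mono[of j i] J(2,4,6) that by cases metis+
  qed
  have yo: "y i \<noteq> od j" if "i \<in> J" "j \<in> J" for i j
  proof
    assume eq: "y i = od j"
    consider "i < j" | "j < i" | "i = j" by linarith
    then show False using mono[of i j] mono[of j i] J(2,4,5) that eq by cases metis+
  qed
  have fin2: "finite (right m a)" "finite (left m b)" for a b using near_factorD[OF m] by auto
  obtain m' where m': "m' \<subseteq> r" "\<And>a. card (right m' a) = card (right m a)" "\<And>b. finite (left m' b)"
    "\<And>b. card (left m' b) + of_bool (b \<in> y ` J) = card (left m b) + of_bool (b \<in> od ` J)"
  proof (rule rewire[OF near_factorD(1)[OF m] fin2, of x J y od])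
    show "inj_on x J" "inj_on y J" "inj_on od J" using neq by (auto intro: inj_onI)
  qed (use J that in auto)
  have "card (left m' b) \<in> {0, 2}" for b
  proof (cases "b \<in> Od")
    case True
    then obtain n where n: "b = od n" using od by blast
    \<comment> \<open>Each odd vertex is served at its own stage at the latest, and it is a donor or
      a receiver but never both.\<close>
    have "\<exists>i\<in>J. b = y i \<or> b = od i"
      using n notJ used_cases by (cases "n \<in> J") blast+
    then have "b \<in> y ` J \<or> b \<in> od ` J" by auto
    moreover have "\<not> (b \<in> y ` J \<and> b \<in> od ` J)"
    proof (rule notI, elim conjE imageE)
      fix i j assume "b = y i" "i \<in> J" "b = od j" "j \<in> J"
      then show False using yo[of i j] by simp
    qed
    ultimately have "b \<in> y ` J \<longleftrightarrow> b \<notin> od ` J" by blast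
    then show ?thesis using m'(4)[of b] True by (cases "b \<in> y ` J") (auto simp: Od_def)
  next
    case False
    then have "b \<notin> y ` J" "b \<notin> od ` J" using J(3) od by auto
    then have "card (left m' b) = card (left m b)" using m'(4)[of b] by simp
    then show ?thesis using False near_factorD(4)[OF m, of b] by (auto simp: Od_def)
  qed
  then show ?thesis using m' near_factorD(2)[OF m] by (intro exI[of _ m']) auto
qed

text \<open>Finitely many odd vertices are repaired by shifting edges along infinitely many cofinite
  vertices of degree 2, so that the defect escapes to infinity.\<close>

lemma repair_finite:
  assumes m: "near_factor m" and fin: "finite {b. card (left m b) = 1}"
    and inf: "infinite {b \<in> cofin. card (left m b) = 2}"
  shows "\<exists>m\<subseteq>r. (\<forall>a\<in>A. card (right m a) = 2) \<and> (\<forall>b. finite (left m b) \<and> card (left m b) \<in> {0, 2})"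
proof (cases "{b. card (left m b) = 1} = {}")
  case True
  have "card (left m b) \<in> {0, 2}" for b
  proof -
    have "card (left m b) \<noteq> 1" using True by blast
    then show ?thesis using near_factorD(4)[OF m, of b] by auto
  qed
  then show ?thesis using near_factorD[OF m] by (intro exI[of _ m]) auto
next
  case nonempty: False
  define Od where "Od = {b. card (left m b) = 1}"
  define Tw where "Tw = {b \<in> cofin. card (left m b) = 2}"
  obtain os where os: "set os = Od" "distinct os" using fin finite_distinct_list unfolding Od_def by blast
  define k where "k = length os"
  have k: "k > 0" using nonempty os(1) by (auto simp: k_def Od_def)
  have Odc: "b \<in> cofin" if "b \<in> Od" for b using that near_factorD(5)[OF m] by (simp add: Od_def)
  \<comment> \<open>The receivers form a queue: first the \<open>k\<close> odd vertices, then the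
    donors in the order in which they gave an edge. Since \<open>k > 0\<close>, the receiver of
    stage \<open>n\<close> is known by then, and the donor of stage \<open>n\<close> is repaid at
    stage \<open>n + k\<close>.\<close>
  define P where "P xs q \<longleftrightarrow> (snd ` set xs \<subseteq> Tw \<longrightarrow> snd q \<in> Tw - snd ` set xs \<and> fst q \<notin> fst ` set xs \<and>
     q \<in> m \<and> (fst q, (os @ map snd xs) ! length xs) \<in> r - m)" for xs and q :: "'a \<times> 'a"
  have "\<exists>q. P xs q" for xs
  proof (cases "snd ` set xs \<subseteq> Tw")
    case True
    let ?t = "(os @ map snd xs) ! length xs"
    have "?t \<in> set (os @ map snd xs)" using k by (intro nth_mem) (simp add: k_def)
    then have "?t \<in> cofin" using Odc os(1) True by (auto simp: Tw_def)
    then have "\<exists>a b. b \<in> Tw - snd ` set xs \<and> a \<notin> fst ` set xs \<and> (a, b) \<in> m \<and> (a, ?t) \<in> r - m"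
      by (intro pick_edge[OF m]) (use inf in \<open>auto simp: Tw_def\<close>)
    then obtain a b where "b \<in> Tw - snd ` set xs" "a \<notin> fst ` set xs" "(a, b) \<in> m" "(a, ?t) \<in> r - m" by blast
    then have "P xs (a, b)" by (simp add: P_def)
    then show ?thesis by blast
  qed (simp add: P_def)
  then obtain f where f: "\<And>n. P (map f [0..<n]) (f n)" using dependent_list_choice[of P] by blast
  define x where "x n = fst (f n)" for n
  define y where "y n = snd (f n)" for n
  define z where "z n = (if n < k then os ! n else y (n - k))" for n
  have yT: "y n \<in> Tw" for n
  proof (induction n rule: less_induct)
    case (less n)
    then have "snd ` set (map f [0..<n]) \<subseteq> Tw" by (auto simp: y_def)
    then show ?case using f[of n] by (simp add: P_def y_def)
  qed
  have sub: "snd ` set (map f [0..<n]) \<subseteq> Tw" for n using yT by (auto simp: y_def)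
  have zt: "(os @ map snd (map f [0..<n])) ! n = z n" for n
  proof (cases "n < k")
    case False
    then have "n - k < n" using k by simp
    with False show ?thesis by (simp add: z_def k_def nth_append y_def)
  qed (simp add: z_def k_def nth_append)
  have F: "y n \<notin> y ` {..<n}" "x n \<notin> x ` {..<n}" "(x n, y n) \<in> m" "(x n, z n) \<in> r - m" for n
  proof -
    have *: "snd (f n) \<in> Tw - snd ` set (map f [0..<n]) \<and> fst (f n) \<notin> fst ` set (map f [0..<n]) \<and>
     f n \<in> m \<and> (fst (f n), (os @ map snd (map f [0..<n])) ! n) \<in> r - m"
      using f[of n] sub[of n] by (simp add: P_def)
    then show "y n \<notin> y ` {..<n}" "x n \<notin> x ` {..<n}" "(x n, y n) \<in> m" "(x n, z n) \<in> r - m"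
      unfolding zt by (auto simp: x_def y_def)
  qed
  have injI': "inj g" if "\<And>n. g n \<notin> g ` {..<n}" for g :: "nat \<Rightarrow> 'a"
    using that by (metis image_eqI injI lessThan_iff linorder_neqE_nat)
  have inj: "inj x" "inj y" using injI' F by blast+
  have disj: "Od \<inter> Tw = {}" by (auto simp: Od_def Tw_def)
  have zlow: "z n \<in> Od" if "n < k" for n using that os(1) by (auto simp: z_def k_def)
  have zhigh: "z n \<in> Tw" if "\<not> n < k" for n using that yT by (simp add: z_def)
  have injz: "inj z"
  proof (rule injI)
    fix i j assume eq: "z i = z j"
    have iff: "i < k \<longleftrightarrow> j < k" using eq zlow zhigh disj by (metis disjoint_iff)
    show "i = j"
    proof (cases "i < k")
      case True
      then have "os ! i = os ! j" "j < k" using eq iff by (auto simp: z_def)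
      then show ?thesis using True os(2) by (simp add: k_def nth_eq_iff_index_eq)
    next
      case False
      then have "y (i - k) = y (j - k)" "\<not> j < k" using eq iff by (auto simp: z_def)
      then have "i - k = j - k" using inj(2) by (simp add: inj_eq)
      then show ?thesis using False \<open>\<not> j < k\<close> by linarith
    qed
  qed
  \<comment> \<open>Every donor is repaid, so the odd vertices are the only ones with a net
    gain.\<close>
  have rz: "range z = Od \<union> range y"
  proof
    show "range z \<subseteq> Od \<union> range y" using zlow by (auto simp: z_def)
    show "Od \<union> range y \<subseteq> range z"
    proof
      fix b assume "b \<in> Od \<union> range y"
      then consider i where "i < k" "b = os ! i" | n where "b = y n"
        using os(1) by (auto simp: k_def in_set_conv_nth)
      then show "b \<in> range z"
      proof cases
        case (1 i)
        then have "b = z i" by (simp add: z_def)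
        then show ?thesis by blast
      next
        case (2 n)
        then have "b = z (n + k)" by (simp add: z_def)
        then show ?thesis by blast
      qed
    qed
  qed
  have fin2: "finite (right m a)" "finite (left m b)" for a b using near_factorD[OF m] by auto
  obtain m' where m': "m' \<subseteq> r" "\<And>a. card (right m' a) = card (right m a)" "\<And>b. finite (left m' b)"
    "\<And>b. card (left m' b) + of_bool (b \<in> range y) = card (left m b) + of_bool (b \<in> range z)"
    by (rule rewire[OF near_factorD(1)[OF m] fin2 inj injz F(3,4)]) (rule that)
  have "card (left m' b) \<in> {0, 2}" for b
  proof (cases "b \<in> Od")
    case True
    then have "b \<notin> range y" "b \<in> range z" using rz disj yT by auto
    then show ?thesis using m'(4)[of b] True by (simp add: Od_def)
  next
    case False
    then have "b \<in> range z \<longleftrightarrow> b \<in> range y" using rz by blast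
    then have "card (left m' b) = card (left m b)" using m'(4)[of b] by simp
    then show ?thesis using False near_factorD(4)[OF m, of b] by (auto simp: Od_def)
  qed
  then show ?thesis using m' near_factorD(2)[OF m] by (intro exI[of _ m']) auto
qed

text \<open>Unused cofinite vertices take the places of used vertices of finite degree.\<close>

lemma activate_cofin:
  assumes m: "near_factor m" and fin: "finite {b. card (left m b) = 1}"
    "finite {b \<in> cofin. card (left m b) = 2}"
  shows "\<exists>m. near_factor m \<and> finite {b. card (left m b) = 1} \<and> infinite {b \<in> cofin. card (left m b) = 2}"
proof -
  define Z where "Z = {b \<in> cofin. card (left m b) = 0}"
  define Us where "Us = {b. b \<notin> cofin \<and> card (left m b) = 2}"
  have c012: "card (left m b) = 0 \<or> card (left m b) = 1 \<or> card (left m b) = 2" for b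
    using near_factorD(4)[OF m, of b] by linarith
  have "cofin \<subseteq> Z \<union> {b. card (left m b) = 1} \<union> {b \<in> cofin. card (left m b) = 2}"
    using c012 by (auto simp: Z_def)
  then have "infinite Z" using infinite_cofin fin by (meson finite_UnI finite_subset)
  then obtain d :: "nat \<Rightarrow> 'a" where d: "inj d" "range d \<subseteq> Z" using infinite_countable_subset by blast
  \<comment> \<open>Otherwise finitely many vertices, each with finitely many edges in
    \<open>m\<close>, would cover the infinite set \<open>A\<close>.\<close>
  have "infinite Us"
  proof
    assume "finite Us"
    let ?S = "Us \<union> {b. card (left m b) = 1} \<union> {b \<in> cofin. card (left m b) = 2}"
    have "A \<subseteq> (\<Union>b\<in>?S. left m b)"
    proof
      fix a assume "a \<in> A"
      then have "right m a \<noteq> {}" using near_factorD(2)[OF m] by fastforce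
      then obtain b where b: "a \<in> left m b" by auto
      then have "card (left m b) \<noteq> 0" using near_factorD(3)[OF m, of b] by auto
      then have "b \<in> ?S" using c012[of b] by (auto simp: Us_def)
      then show "a \<in> (\<Union>b\<in>?S. left m b)" using b by blast
    qed
    moreover have "finite (\<Union>b\<in>?S. left m b)" using \<open>finite Us\<close> fin near_factorD(3)[OF m] by blast
    ultimately show False using inf_A finite_subset by blast
  qed
  \<comment> \<open>Finitely many vertices of \<open>A\<close> are not adjacent to the cofinite
    vertex in question, and they block only finitely many members of \<open>Us\<close>; any other
    member can be moved onto it.\<close>
  have "\<exists>b. b \<in> Us \<and> b \<notin> set xs \<and> left m b \<subseteq> left r (d (length xs))" for xs
  proof -
    let ?F = "A - left r (d (length xs))"
    have "d (length xs) \<in> cofin" using d(2) by (auto simp: Z_def)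
    then have "finite (\<Union>a\<in>?F. right m a)" using cofinD near_factorD(6)[OF m] by blast
    then have "infinite (Us - (set xs \<union> (\<Union>a\<in>?F. right m a)))" using \<open>infinite Us\<close>
      by (intro Diff_infinite_finite) auto
    then obtain b where b: "b \<in> Us - (set xs \<union> (\<Union>a\<in>?F. right m a))" by (metis finite.emptyI ex_in_conv)
    have "left m b \<subseteq> left r (d (length xs))"
    proof
      fix a assume a: "a \<in> left m b"
      then have "a \<in> A" using near_factorD(1)[OF m] sides by auto
      then show "a \<in> left r (d (length xs))" using a b by auto
    qed
    then show ?thesis using b by blast
  qed
  then have "\<exists>f. \<forall>n. f n \<in> Us \<and> f n \<notin> set (map f [0..<n]) \<and> left m (f n) \<subseteq> left r (d (length (map f [0..<n])))"
    by (rule dependent_list_choice)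
  then obtain f where f: "\<And>n. f n \<in> Us" "\<And>n. f n \<notin> f ` {0..<n}" "\<And>n. left m (f n) \<subseteq> left r (d n)"
    by auto
  have injf: "inj f" using f(2) by (metis atLeastLessThan_iff image_eqI injI le0 linorder_neqE_nat)
  define \<sigma> where "\<sigma> b = (if b \<in> range f then d (inv f b) else b)" for b
  have \<sigma>f: "\<sigma> (f n) = d n" for n using injf by (simp add: \<sigma>_def)
  define m' where "m' = (\<lambda>(a, b). (a, \<sigma> b)) ` m"
  have dZ: "left m (d n) = {}" for n
  proof -
    have "d n \<in> Z" using d(2) by blast
    then have "card (left m (d n)) = 0" by (simp add: Z_def)
    then show ?thesis using near_factorD(3)[OF m, of "d n"] by (simp only: card_0_eq)
  qed
  have unused: "(a, d n) \<notin> m" for a n using dZ[of n] by (metis empty_iff mem_right_left(2))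
  have dcof: "d n \<in> cofin" for n using d(2) by (auto simp: Z_def)
  have ncof: "f n \<notin> cofin" "card (left m (f n)) = 2" for n using f(1) by (auto simp: Us_def)
  have Ld: "left m' (d n) = left m (f n)" for n
  proof
    show "left m (f n) \<subseteq> left m' (d n)" using \<sigma>f[of n] by (force simp: m'_def)
    show "left m' (d n) \<subseteq> left m (f n)"
    proof
      fix a assume "a \<in> left m' (d n)"
      then obtain b where b: "(a, b) \<in> m" "\<sigma> b = d n" by (auto simp: m'_def)
      have "b \<in> range f" using b unused by (auto simp: \<sigma>_def split: if_splits)
      then obtain k where "b = f k" by blast
      then show "a \<in> left m (f n)" using b \<sigma>f d(1) by (auto simp: inj_eq)
    qed
  qed
  have Lf: "left m' (f n) = {}" for n
    using ncof(1) dcof by (auto simp: m'_def \<sigma>_def split: if_splits) metis+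
  have Lo: "left m' b = left m b" if "b \<notin> range d" "b \<notin> range f" for b
  proof
    show "left m' b \<subseteq> left m b"
    proof
      fix a assume "a \<in> left m' b"
      then obtain c where c: "(a, c) \<in> m" "\<sigma> c = b" by (auto simp: m'_def)
      then have "c = b" using \<open>b \<notin> range d\<close> by (auto simp: \<sigma>_def split: if_splits)
      then show "a \<in> left m b" using c by simp
    qed
    have "\<sigma> b = b" using \<open>b \<notin> range f\<close> by (simp add: \<sigma>_def)
    then show "left m b \<subseteq> left m' b" by (force simp: m'_def)
  qed
  have card': "card (left m' b) = 2 \<and> b \<in> cofin \<or> card (left m' b) = 0 \<or> left m' b = left m b" for b
  proof (cases "b \<in> range d \<or> b \<in> range f")
    case True
    then show ?thesis using Ld Lf ncof dcof by auto
  qed (simp add: Lo)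
  have fin': "finite (left m' b)" for b
  proof (cases "b \<in> range d \<or> b \<in> range f")
    case True
    then show ?thesis using Ld Lf near_factorD(3)[OF m] by auto
  qed (simp add: Lo near_factorD(3)[OF m])
  have "m' \<subseteq> r"
  proof
    fix e assume "e \<in> m'"
    then obtain a b where ab: "(a, b) \<in> m" "e = (a, \<sigma> b)" by (auto simp: m'_def)
    show "e \<in> r"
    proof (cases "b \<in> range f")
      case True
      then obtain n where "b = f n" by blast
      then show ?thesis using ab f(3)[of n] \<sigma>f by auto
    next
      case False
      then show ?thesis using ab near_factorD(1)[OF m] by (auto simp: \<sigma>_def)
    qed
  qed
  moreover have "card (right m' a) = 2" if "a \<in> A" for a
  proof -
    have "right m' a = \<sigma> ` right m a" by (force simp: m'_def)
    \<comment> \<open>No vertex \<open>d n\<close> was in use, so a moved right end cannot collide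
      with an unmoved one.\<close>
    moreover have "inj_on \<sigma> (right m a)"
    proof (rule inj_onI)
      fix b c assume bc: "b \<in> right m a" "c \<in> right m a" "\<sigma> b = \<sigma> c"
      have nd: "b \<notin> range d" "c \<notin> range d" using bc unused by auto
      show "b = c"
      proof (cases "b \<in> range f")
        case True
        then obtain n where n: "b = f n" by blast
        then have "c \<in> range f" using bc nd \<sigma>f[of n] by (auto simp: \<sigma>_def split: if_splits)
        then obtain k where "c = f k" by blast
        then show ?thesis using n bc \<sigma>f d(1) by (simp add: inj_eq)
      next
        case False
        then have "\<sigma> b = b" by (simp add: \<sigma>_def)
        then show ?thesis using bc nd by (auto simp: \<sigma>_def split: if_splits)
      qed
    qed
    ultimately show ?thesis using near_factorD(2)[OF m that] by (simp add: card_image)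
  qed
  moreover have "card (left m' b) \<le> 2" for b using card'[of b] near_factorD(4)[OF m, of b] by auto
  moreover have "b \<in> cofin" if "card (left m' b) = 1" for b
    using card'[of b] that near_factorD(5)[OF m, of b] by auto
  ultimately have "near_factor m'" using fin' by (simp add: near_factor_def)
  moreover have "finite {b. card (left m' b) = 1}"
  proof (rule finite_subset[OF _ fin(1)])
    show "{b. card (left m' b) = 1} \<subseteq> {b. card (left m b) = 1}"
    proof
      fix b assume "b \<in> {b. card (left m' b) = 1}"
      then show "b \<in> {b. card (left m b) = 1}" using card'[of b] by auto
    qed
  qed
  moreover have "infinite {b \<in> cofin. card (left m' b) = 2}"
  proof
    assume "finite {b \<in> cofin. card (left m' b) = 2}"
    moreover have "range d \<subseteq> {b \<in> cofin. card (left m' b) = 2}" using Ld ncof dcof by auto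
    ultimately show False using d(1) by (meson finite_imageD finite_subset infinite_UNIV_nat)
  qed
  ultimately show ?thesis by blast
qed

theorem ex_factor:
  "\<exists>m\<subseteq>r. (\<forall>a\<in>A. card (right m a) = 2) \<and> (\<forall>b. finite (left m b) \<and> card (left m b) \<in> {0, 2})"
proof -
  obtain m where m: "near_factor m" using ex_near_factor by blast
  show ?thesis
  proof (cases "finite {b. card (left m b) = 1}")
    case False
    then show ?thesis by (rule repair_infinite[OF m])
  next
    case True
    show ?thesis
    proof (cases "finite {b \<in> cofin. card (left m b) = 2}")
      case False
      then show ?thesis by (rule repair_finite[OF m True])
    next
      case fin: True
      obtain m' where "near_factor m'" "finite {b. card (left m' b) = 1}"
        "infinite {b \<in> cofin. card (left m' b) = 2}"
        using activate_cofin[OF m True fin] by blast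
      then show ?thesis by (rule repair_finite)
    qed
  qed
qed

end

section \<open>From graphs to edge relations and back\<close>

theorem theorem2p11:
  fixes G :: "'a ugraph" and A B :: "'a set"
  assumes "bipartite G A B"
    and "infinite A" and "infinite B"
    and "dHp_graph G A B"
    and "\<forall>v\<in>A. finite (neighbours G v)"
    and "\<forall>v\<in>B. finite (neighbours G v) \<or>
           (\<exists>F. finite F \<and> F \<subseteq> A \<and> neighbours G v = A - F)"
  shows "\<exists>\<H>. (\<forall>H\<in>\<H>. subgraph H G \<and> two_regular H) \<and>
           pairwise (\<lambda>H K. disjnt (verts H) (verts K)) \<H> \<and>
           A \<subseteq> (\<Union>H\<in>\<H>. verts H)"
proof -
  have simple: "simple_graph G" and V: "verts G = A \<union> B" and AB: "A \<inter> B = {}"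
    and edges: "\<And>e. e \<in> edges G \<Longrightarrow> \<exists>a\<in>A. \<exists>b\<in>B. e = {a, b}"
    using assms(1) by (auto simp: bipartite_def)
  have side: "b \<in> B" if "{a, b} \<in> edges G" "a \<in> A" for a b
    using edges[OF that(1)] that(2) AB by (auto simp: doubleton_eq_iff)
  have side': "a \<in> A" if "{a, b} \<in> edges G" "b \<in> B" for a b
    using edges[OF that(1)] that(2) AB by (auto simp: doubleton_eq_iff)
  define r where "r = {(a, b). a \<in> A \<and> {a, b} \<in> edges G}"
  have rB: "b \<in> B" if "(a, b) \<in> r" for a b using that side by (auto simp: r_def)
  have right: "right r a = neighbours G a" if "a \<in> A" for a
    using that by (auto simp: r_def neighbours_def insert_commute)
  have left: "left r b = neighbours G b" if "b \<in> B" for b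
    using that side' by (auto simp: r_def neighbours_def)
  have fin_right: "finite (right r a)" for a
  proof (cases "a \<in> A")
    case True
    then show ?thesis using right assms(5) by simp
  next
    case False
    then have "right r a = {}" by (auto simp: r_def)
    then show ?thesis by simp
  qed
  have N2: "{b. \<exists>x\<in>X. \<exists>y\<in>X. x \<noteq> y \<and> (x, b) \<in> r \<and> (y, b) \<in> r} = N2 G X" if X: "X \<subseteq> A" for X
  proof (intro set_eqI iffI)
    fix b assume "b \<in> {b. \<exists>x\<in>X. \<exists>y\<in>X. x \<noteq> y \<and> (x, b) \<in> r \<and> (y, b) \<in> r}"
    then obtain x y where xy: "x \<in> X" "y \<in> X" "x \<noteq> y" "(x, b) \<in> r" "(y, b) \<in> r" by blast
    then have "x \<in> neighbours G b \<inter> X" "y \<in> neighbours G b \<inter> X" by (auto simp: r_def neighbours_def)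
    then have "at_least_two (neighbours G b \<inter> X)" using xy(3) unfolding at_least_two_def by blast
    then show "b \<in> N2 G X" using rB[OF xy(4)] V by (simp add: N2_def)
  next
    fix b assume "b \<in> N2 G X"
    then obtain x y where xy: "x \<in> neighbours G b \<inter> X" "y \<in> neighbours G b \<inter> X" "x \<noteq> y"
      by (auto simp: N2_def at_least_two_def)
    then have "(x, b) \<in> r" "(y, b) \<in> r" using X by (auto simp: r_def neighbours_def)
    then show "b \<in> {b. \<exists>x\<in>X. \<exists>y\<in>X. x \<noteq> y \<and> (x, b) \<in> r \<and> (y, b) \<in> r}" using xy by blast
  qed
  have dHp: "\<exists>f. inj_on f X \<and> f ` X \<subseteq> N2 G X" if "X \<subseteq> A" "x \<in> X" "y \<in> X" "x \<noteq> y" for X x y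
    using assms(4) that unfolding dHp_graph_def at_least_two_def lepoll_def by blast
  interpret cofinite_dHp A r
  proof
    show "infinite A" by (rule assms(2))
    show "a \<in> A \<and> b \<notin> A" if "(a, b) \<in> r" for a b using that rB[OF that] AB by (auto simp: r_def)
    show "finite (right r a)" for a by (rule fin_right)
    show "finite (left r b) \<or> finite (A - left r b)" for b
    proof (cases "b \<in> B")
      case True
      then have "finite (left r b) \<or> (\<exists>F. finite F \<and> F \<subseteq> A \<and> left r b = A - F)"
        using assms(6) left by simp
      then show ?thesis by (metis Diff_Diff_Int finite_Int)
    next
      case False
      then have "left r b = {}" using rB by auto
      then show ?thesis by simp
    qed
    show "infinite {b. \<exists>x\<in>X. \<exists>y\<in>X. x \<noteq> y \<and> (x, b) \<in> r \<and> (y, b) \<in> r}" if X: "X \<subseteq> A" "infinite X" for X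
      unfolding N2[OF X(1)]
    proof
      assume fin: "finite (N2 G X)"
      obtain x where x: "x \<in> X" using X(2) by (metis ex_in_conv finite.emptyI)
      have "infinite (X - {x})" using X(2) by simp
      then obtain y where y: "y \<in> X - {x}" by (metis ex_in_conv finite.emptyI)
      obtain f where "inj_on f X" "f ` X \<subseteq> N2 G X" using dHp[OF X(1) x, of y] y by blast
      then show False using fin X(2) inj_on_finite by blast
    qed
    show "card X \<le> card {b. \<exists>x\<in>X. \<exists>y\<in>X. x \<noteq> y \<and> (x, b) \<in> r \<and> (y, b) \<in> r}"
      if X: "X \<subseteq> A" "2 \<le> card X" for X
    proof -
      have finX: "finite X" using X(2) card.infinite by fastforce
      obtain Y where Y: "Y \<subseteq> X" "card Y = 2" using X(2) obtain_subset_with_card_n by metis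
      then obtain x y where xy: "x \<in> X" "y \<in> X" "x \<noteq> y" by (auto simp: card_2_iff)
      obtain f where f: "inj_on f X" "f ` X \<subseteq> N2 G X" using dHp[OF X(1) xy] by blast
      have "N2 G X \<subseteq> (\<Union>x\<in>X. right r x)" unfolding N2[OF X(1), symmetric] by auto
      then have "finite (N2 G X)" using finX fin_right by (meson finite_UN_I finite_subset)
      then show ?thesis unfolding N2[OF X(1)] using f card_inj_on_le by blast
    qed
  qed
  obtain m where m: "m \<subseteq> r" "\<And>a. a \<in> A \<Longrightarrow> card (right m a) = 2" "\<And>b. finite (left m b)"
    "\<And>b. card (left m b) \<in> {0, 2}"
    using ex_factor by blast
  have mAB: "a \<in> A" "b \<in> B" "a \<notin> B" "b \<notin> A" "{a, b} \<in> edges G" if "(a, b) \<in> m" for a b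
    using that m(1) rB AB by (auto simp: r_def)
  \<comment> \<open>Outside \<open>A\<close> only right ends of \<open>m\<close> are taken, so
    vertices of degree 0 drop out and the others have degree 2.\<close>
  define H :: "'a ugraph" where "H = (A \<union> snd ` m, (\<lambda>(a, b). {a, b}) ` m)"
  have HE: "{u, v} \<in> edges H \<longleftrightarrow> (u, v) \<in> m \<or> (v, u) \<in> m" for u v
  proof
    assume "{u, v} \<in> edges H"
    then obtain a b where "(a, b) \<in> m" "{u, v} = {a, b}" by (auto simp: H_def)
    then show "(u, v) \<in> m \<or> (v, u) \<in> m" by (auto simp: doubleton_eq_iff)
  next
    assume "(u, v) \<in> m \<or> (v, u) \<in> m"
    then have "{u, v} \<in> edges H \<or> {v, u} \<in> edges H" unfolding H_def by force
    then show "{u, v} \<in> edges H" by (simp add: insert_commute)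
  qed
  have HA: "neighbours H a = right m a" if "a \<in> A" for a
  proof (rule set_eqI)
    fix u
    have "(u, a) \<notin> m" using mAB(4)[of u a] that by blast
    then show "u \<in> neighbours H a \<longleftrightarrow> u \<in> right m a" unfolding neighbours_def mem_Collect_eq HE by simp
  qed
  have HB: "neighbours H b = left m b" if "b \<notin> A" for b
  proof (rule set_eqI)
    fix u
    have "(b, u) \<notin> m" using mAB(1)[of b u] that by blast
    then show "u \<in> neighbours H b \<longleftrightarrow> u \<in> left m b" unfolding neighbours_def mem_Collect_eq HE by simp
  qed
  have "two_regular H" unfolding two_regular_def
  proof
    fix v assume v: "v \<in> verts H"
    show "card (neighbours H v) = 2"
    proof (cases "v \<in> A")
      case True
      then show ?thesis using HA m(2) by simp
    next
      case False
      then obtain a where "a \<in> left m v" using v by (auto simp: H_def)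
      then have "card (left m v) \<noteq> 0" using m(3)[of v] by auto
      then show ?thesis using HB[OF False] m(4)[of v] by auto
    qed
  qed
  moreover have "subgraph H G"
  proof -
    have e: "edges H \<subseteq> edges G" using mAB by (auto simp: H_def)
    have "card e = 2" if "e \<in> edges H" for e using that e simple by (auto simp: simple_graph_def)
    moreover have "e \<subseteq> verts H" if "e \<in> edges H" for e
    proof -
      obtain a b where ab: "(a, b) \<in> m" "e = {a, b}" using \<open>e \<in> edges H\<close> by (auto simp: H_def)
      then have "a \<in> A" "b \<in> snd ` m" using mAB(1) by (blast, force)
      then show ?thesis using ab(2) by (simp add: H_def)
    qed
    moreover have "verts H \<subseteq> verts G" using mAB V by (auto simp: H_def)
    ultimately show ?thesis using e by (simp add: subgraph_def simple_graph_def)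
  qed
  moreover have "A \<subseteq> verts H" by (simp add: H_def)
  \<comment> \<open>A 2-regular subgraph need not be connected, so \<open>H\<close> alone serves as
    the collection; its components are the cycles and double rays.\<close>
  ultimately show ?thesis by (intro exI[of _ "{H}"]) simp
qed

end
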